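(* Let $d>1$ be odd, $0\le r_0<r_1\le\infty$, and let $f:A(r_0,r_1)\to\mathbb{C}$ be polyharmonic of infinite order and type $\tau$ with $\tau<1/(2r_0)$. Fix $k\in\mathbb{N}_0$, $l\in\{1,\dots,a_k\}$. Then for every $v_0$ with $r_0<e^{v_0}<\min\{r_1,1/(2\tau)\}$ the double series $$F_{k,l}(z)=\sum_{n=0}^\infty\sum_{j=0}^n D^{(n)}\widetilde f_{k,l}(v_0)\,\frac{e^{-\lambda_j(k)v_0}}{q_n'(\lambda_j(k))}\,z^{\lambda_j(k)}$$ converges absolutely and uniformly on compact subsets of $\{z\in\mathbb{C}:0<|z|<1/(2\tau)\}$, and $F_{k,l}(r)=f_{k,l}(r)$ for all $r\in(r_0,\min\{r_1,1/(2\tau)\})$.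
   Context: Conventions: $1/(2\tau)=\infty$ if $\tau=0$, $1/(2r_0)=\infty$ if $r_0=0$. $A(r_0,r_1)=\{x\in\mathbb{R}^d: r_0<|x|<r_1\}$. A function $f:G\to\mathbb{C}$ on a domain $G\subset\mathbb{R}^d$ is polyharmonic of infinite order and type $\tau\ge0$ if $f\in C^\infty(G)$ and for every compact $K\subset G$ and every $\varepsilon>0$ there is $C_{K,\varepsilon}>0$ with $\max_{x\in K}|\Delta^p f(x)|\le C_{K,\varepsilon}(2p)!(\tau+\varepsilon)^{2p}$ for all $p\in\mathbb{N}_0$. $Y_{k,l}$, $l=1,\dots,a_k$, is an orthonormal basis (in $L^2(\mathbb{S}^{d-1},d\theta)$) of harmonic homogeneous polynomials of degree $k$; $f_{k,l}(r)=\int_{\mathbb{S}^{d-1}}f(r\theta)\overline{Y_{k,l}(\theta)}d\theta$, $\widetilde f_{k,l}(v)=f_{k,l}(e^v)$. Exponents $\lambda_{2j}(k)=k+2j$, $\lambda_{2j+1}(k)=-k-d+2+2j$ (integers, pairwise distinct since $d$ is odd), so $z^{\lambda_j(k)}$ are integer powers. $q_n(\lambda)=\prod_{j=0}^n(\lambda-\lambda_j(k))$. $D^{(n)}g=(\frac{d}{dv}-\lambda_0(k))\cdots(\frac{d}{dv}-\lambda_{n-1}(k))g$, $D^{(0)}g=g$. *)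

theory Defs
  imports "HOL-Analysis.Analysis" "HOL-Computational_Algebra.Polynomial"
begin

definition pd :: "'n::finite \<Rightarrow> (real^'n \<Rightarrow> complex) \<Rightarrow> real^'n \<Rightarrow> complex" where
  "pd i g x = vector_derivative (\<lambda>t. g (x + t *\<^sub>R axis i 1)) (at 0)"

fun pds :: "'n::finite list \<Rightarrow> (real^'n \<Rightarrow> complex) \<Rightarrow> real^'n \<Rightarrow> complex" where
  "pds [] g = g"
| "pds (i # is) g = pd i (pds is g)"

definition smooth_on :: "(real^'n::finite) set \<Rightarrow> (real^'n \<Rightarrow> complex) \<Rightarrow> bool" where
  "smooth_on G g \<longleftrightarrow>
     (\<forall>is. continuous_on G (pds is g) \<and>
        (\<forall>i. \<forall>x\<in>G. (\<lambda>t. pds is g (x + t *\<^sub>R axis i 1)) differentiable (at 0)))"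

definition lap :: "(real^'n::finite \<Rightarrow> complex) \<Rightarrow> real^'n \<Rightarrow> complex" where
  "lap g x = (\<Sum>i\<in>UNIV. pd i (pd i g) x)"

definition polyharmonic_inf :: "(real^'n::finite) set \<Rightarrow> real \<Rightarrow> (real^'n \<Rightarrow> complex) \<Rightarrow> bool" where
  "polyharmonic_inf G \<tau> f \<longleftrightarrow> smooth_on G f \<and>
     (\<forall>K \<epsilon>. compact K \<and> K \<subseteq> G \<and> \<epsilon> > 0 \<longrightarrow>
        (\<exists>C>0. \<forall>p::nat. \<forall>x\<in>K. norm ((lap ^^ p) f x) \<le> C * fact (2*p) * (\<tau> + \<epsilon>) ^ (2*p)))"

definition inv2 :: "real \<Rightarrow> ereal" where
  "inv2 t = (if t = 0 then \<infinity> else ereal (1 / (2 * t)))"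

definition annulus :: "real \<Rightarrow> ereal \<Rightarrow> (real^'n::finite) set" where
  "annulus r0 r1 = {x. r0 < norm x \<and> ereal (norm x) < r1}"

text \<open>Integral over the unit sphere w.r.t. surface measure, via the cone construction:
  \<integral>_S h d\<sigma> = d * \<integral>_{B(0,1)} h(x/|x|) dx.\<close>
definition sph_int :: "(real^'n::finite \<Rightarrow> complex) \<Rightarrow> complex" where
  "sph_int h = of_nat CARD('n) * integral (ball 0 1) (\<lambda>x. h (x /\<^sub>R norm x))"

definition hom_harm_poly :: "nat \<Rightarrow> (real^'n::finite \<Rightarrow> complex) \<Rightarrow> bool" where
  "hom_harm_poly k P \<longleftrightarrow>
     (\<exists>c :: ('n \<Rightarrow> nat) \<Rightarrow> complex.
        \<forall>x. P x = (\<Sum>\<alpha>\<in>{\<alpha>. (\<Sum>i\<in>UNIV. \<alpha> i) = k}. c \<alpha> * of_real (\<Prod>i\<in>UNIV. (x $ i) ^ \<alpha> i)))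
     \<and> (\<forall>x. lap P x = 0)"

definition sph_harm_onb :: "nat \<Rightarrow> nat \<Rightarrow> (nat \<Rightarrow> real^'n::finite \<Rightarrow> complex) \<Rightarrow> bool" where
  "sph_harm_onb k a Y \<longleftrightarrow>
     (\<forall>l\<in>{1..a}. hom_harm_poly k (Y l)) \<and>
     (\<forall>i\<in>{1..a}. \<forall>j\<in>{1..a}. sph_int (\<lambda>\<theta>. Y i \<theta> * cnj (Y j \<theta>)) = (if i = j then 1 else 0)) \<and>
     (\<forall>P. hom_harm_poly k P \<longrightarrow> (\<exists>c. \<forall>x. P x = (\<Sum>l=1..a. c l * Y l x)))"

definition fcoef :: "(real^'n::finite \<Rightarrow> complex) \<Rightarrow> (real^'n \<Rightarrow> complex) \<Rightarrow> real \<Rightarrow> complex" where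
  "fcoef f Y r = sph_int (\<lambda>\<theta>. f (r *\<^sub>R \<theta>) * cnj (Y \<theta>))"

definition lam :: "nat \<Rightarrow> nat \<Rightarrow> nat \<Rightarrow> int" where
  "lam d k j = (if even j then int k + int j
                else - int k - int d + 2 + 2 * int (j div 2))"

definition qpoly :: "nat \<Rightarrow> nat \<Rightarrow> nat \<Rightarrow> complex poly" where
  "qpoly d k n = (\<Prod>j\<in>{0..n}. [: - of_int (lam d k j), 1 :])"

fun Dop :: "(nat \<Rightarrow> int) \<Rightarrow> nat \<Rightarrow> (real \<Rightarrow> complex) \<Rightarrow> real \<Rightarrow> complex" where
  "Dop L 0 g = g"
| "Dop L (Suc n) g = (\<lambda>v. vector_derivative (Dop L n g) (at v) - of_int (L n) * Dop L n g v)"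

end

(* In v = log |x| the Laplacian acts on the k-th spherical coefficients as
   exp (-2 v) (d/dv - k) (d/dv + k + d - 2), so D^(2p) of the coefficient of f is exp (2 p v) times
   the coefficient of Lap^p f, and the polyharmonicity estimate bounds D^(n) at v by
   C (n + 1) n! (s exp v)^n for every s > tau; odd n are reached by interpolation.  The series is the
   Newton-Taylor expansion in the divided differences phi_n of exp (lambda x) at the exponents.  These
   exponents fill an interval of integers up to boundedly many gaps, so n! phi_n (x) is bounded by a
   polynomial in n times (1 + exp x)^n.  The n-th term at z is therefore bounded by a polynomial
   times (s (exp v0 + |z|))^n, and the remainder at v is an integral over t between v0 and v of terms
   bounded by (s (exp t + exp v))^n; both decay because all radii are below 1 / (2 tau).

   The radial equation needs the self-adjointness of the spherical Laplacian.  It comes from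
   the rotation invariance of Lebesgue measure, itself proved by writing a plane rotation as a product
   of three shears. *)
theory Submission
  imports Defs
begin

text \<open>No cancellation inside the divided differences is exploited: phi_n is bounded by the sum
  of the absolute values of its terms. One estimate therefore serves both absolute convergence at
  complex z and the remainder at real v. The price is that the two radii enter with a plus sign, as
  in exp v0 + |z|. Here lies the 2 of 1 / (2 tau): two radii below this value add up to less than 1
  / tau, and an s > tau still fits in between. Factors polynomial in n do not affect a geometric
  rate, so the gaps between the exponents and the odd orders may be estimated crudely.

  The hypothesis concerns powers of the Laplacian, hence even orders only. On a fixed interval the
  first derivative of a coefficient is controlled by the coefficient and the left side of its
  second-order equation; this draws on the next even order and costs one factor n + 1.

  A spherical integral is an integral over the ball of a function constant along rays, so it
  inherits rotation invariance from Lebesgue measure. Differentiating this invariance in the angle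
  takes the place of integration by parts on the sphere.\<close>

section \<open>Rotations and Lebesgue measure\<close>

text \<open>Fubini with the coordinate \<open>b\<close> innermost, the form in which a shear along
  \<open>b\<close> becomes a translation of the inner variable.\<close>

lemma nn_integral_lborel_split_coordinate:
  fixes g :: "'a::euclidean_space \<Rightarrow> ennreal"
  assumes [measurable]: "g \<in> borel_measurable borel" and b: "b \<in> Basis"
  shows "(\<integral>\<^sup>+x. g x \<partial>lborel) =
    (\<integral>\<^sup>+x. \<integral>\<^sup>+y. g (\<Sum>a\<in>Basis. (x(b := y)) a *\<^sub>R a) \<partial>lborel \<partial>(\<Pi>\<^sub>M a\<in>Basis - {b}. lborel))"
proof -
  interpret product_sigma_finite "\<lambda>_::'a. lborel :: real measure" by standard
  have ins: "insert b (Basis - {b}) = (Basis :: 'a set)" using b by auto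
  have "(\<integral>\<^sup>+x. g x \<partial>lborel) = (\<integral>\<^sup>+x. g (\<Sum>a\<in>Basis. x a *\<^sub>R a) \<partial>(\<Pi>\<^sub>M a\<in>Basis. lborel))"
    by (subst lborel_eq, subst nn_integral_distr) auto
  also have "\<dots> = (\<integral>\<^sup>+x. g (\<Sum>a\<in>Basis. x a *\<^sub>R a) \<partial>(\<Pi>\<^sub>M a\<in>insert b (Basis - {b}). lborel))"
    by (simp only: ins)
  also have "\<dots> = (\<integral>\<^sup>+x. \<integral>\<^sup>+y. g (\<Sum>a\<in>Basis. (x(b := y)) a *\<^sub>R a) \<partial>lborel \<partial>(\<Pi>\<^sub>M a\<in>Basis - {b}. lborel))"
    by (subst product_nn_integral_insert) (auto simp: ins)
  finally show ?thesis .
qed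

definition shear :: "'a::euclidean_space \<Rightarrow> 'a \<Rightarrow> real \<Rightarrow> 'a \<Rightarrow> 'a" where
  "shear b c s x = x + (s * (x \<bullet> c)) *\<^sub>R b"

lemma borel_measurable_shear [measurable]: "shear b c s \<in> borel_measurable borel"
  unfolding shear_def by measurable

text \<open>Since \<open>c\<close> differs from \<open>b\<close>, the displacement
  \<open>s * x c\<close> is constant for the inner integral over the coordinate \<open>b\<close>,
  and one-dimensional Lebesgue measure is translation invariant.\<close>

lemma distr_lborel_shear:
  fixes b c :: "'a::euclidean_space"
  assumes b: "b \<in> Basis" and c: "c \<in> Basis" and bc: "b \<noteq> c"
  shows "distr lborel borel (shear b c s) = lborel"
proof (rule measure_eqI)
  fix A assume "A \<in> sets (distr lborel borel (shear b c s))"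
  then have A [measurable]: "A \<in> sets borel" by simp
  let ?f = "indicator A :: 'a \<Rightarrow> ennreal"
  let ?P = "\<lambda>x y. \<Sum>a\<in>Basis. (x(b := y)) a *\<^sub>R a :: 'a"
  have sh: "shear b c s (?P x y) = ?P x (s * x c + y)" for x y
  proof (rule euclidean_eqI)
    fix e :: 'a assume e: "e \<in> Basis"
    show "shear b c s (?P x y) \<bullet> e = ?P x (s * x c + y) \<bullet> e"
      using e b c bc
      by (cases "e = b") (auto simp: shear_def inner_add_left inner_sum_left_Basis inner_Basis)
  qed
  have "emeasure (distr lborel borel (shear b c s)) A = (\<integral>\<^sup>+x. ?f (shear b c s x) \<partial>lborel)"
    using nn_integral_distr[of "shear b c s" lborel borel ?f] by (simp add: nn_integral_indicator)
  also have "\<dots> = (\<integral>\<^sup>+x. \<integral>\<^sup>+y. ?f (?P x (s * x c + y)) \<partial>lborel \<partial>(\<Pi>\<^sub>M a\<in>Basis - {b}. lborel))"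
    by (subst nn_integral_lborel_split_coordinate[OF _ b]) (simp_all only: sh, measurable)
  also have "\<dots> = (\<integral>\<^sup>+x. \<integral>\<^sup>+y. ?f (?P x y) \<partial>lborel \<partial>(\<Pi>\<^sub>M a\<in>Basis - {b}. lborel))"
  proof (rule nn_integral_cong)
    fix x :: "'a \<Rightarrow> real" assume "x \<in> space (\<Pi>\<^sub>M a\<in>Basis - {b}. lborel)"
    have "(\<lambda>y. ?P x y) \<in> borel_measurable borel"
      by (intro borel_measurable_sum borel_measurable_scaleR) (auto simp: fun_upd_def)
    then have "(\<lambda>y. ?f (?P x y)) \<in> borel_measurable borel" by measurable
    from nn_integral_real_affine[OF this, of 1 "s * x c"]
    show "(\<integral>\<^sup>+y. ?f (?P x (s * x c + y)) \<partial>lborel) = (\<integral>\<^sup>+y. ?f (?P x y) \<partial>lborel)" by simp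
  qed
  also have "\<dots> = (\<integral>\<^sup>+x. ?f x \<partial>lborel)"
    by (subst nn_integral_lborel_split_coordinate[OF _ b]) auto
  finally show "emeasure (distr lborel borel (shear b c s)) A = emeasure lborel A" by simp
qed simp

text \<open>For distinct basis vectors this is the rotation by \<open>t\<close> in their plane,
  turning \<open>b\<close> towards \<open>c\<close> and fixing the orthogonal complement.\<close>

definition rot :: "'a::euclidean_space \<Rightarrow> 'a \<Rightarrow> real \<Rightarrow> 'a \<Rightarrow> 'a" where
  "rot b c t x = x + (cos t - 1) *\<^sub>R ((x \<bullet> b) *\<^sub>R b + (x \<bullet> c) *\<^sub>R c) + sin t *\<^sub>R ((x \<bullet> b) *\<^sub>R c - (x \<bullet> c) *\<^sub>R b)"

lemma borel_measurable_rot [measurable]: "rot b c t \<in> borel_measurable borel"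
  unfolding rot_def by measurable

lemma norm_rot:
  fixes b c :: "'a::euclidean_space"
  assumes b: "b \<in> Basis" and c: "c \<in> Basis" and bc: "b \<noteq> c"
  shows "norm (rot b c t x) = norm x"
proof -
  have o: "b \<bullet> c = 0" "c \<bullet> b = 0" "b \<bullet> b = 1" "c \<bullet> c = 1" using assms by (auto simp: inner_Basis)
  define p q where "p = x \<bullet> b" and "q = x \<bullet> c"
  have pq: "x \<bullet> b = p" "x \<bullet> c = q" "b \<bullet> x = p" "c \<bullet> x = q" by (auto simp: p_def q_def inner_commute)
  have cs: "cos t * cos t = 1 - sin t * sin t"
    using sin_cos_squared_add[of t] by (simp add: power2_eq_square algebra_simps)
  have "rot b c t x \<bullet> rot b c t x = x \<bullet> x + (p\<^sup>2 + q\<^sup>2) * (2 * (cos t - 1) + (cos t - 1)\<^sup>2 + (sin t)\<^sup>2)"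
    unfolding rot_def by (simp add: inner_simps pq o) (simp add: algebra_simps power2_eq_square cs)
  also have "2 * (cos t - 1) + (cos t - 1)\<^sup>2 + (sin t)\<^sup>2 = 0"
    using sin_cos_squared_add[of t] by (simp add: power2_eq_square algebra_simps)
  finally show ?thesis by (simp add: norm_eq_sqrt_inner)
qed

text \<open>The factorisation rests on \<open>tan (t / 2) * sin t = 1 - cos t\<close> and
  \<open>tan (t / 2) * (cos t + 1) = sin t\<close>. Half turns are excluded because the shear
  parameter becomes infinite; the later use is at angles near 0.\<close>

lemma rot_eq_shears:
  fixes b c :: "'a::euclidean_space"
  assumes b: "b \<in> Basis" and c: "c \<in> Basis" and bc: "b \<noteq> c" and t: "cos (t / 2) \<noteq> 0"
  shows "rot b c t = shear b c (- tan (t / 2)) \<circ> shear c b (sin t) \<circ> shear b c (- tan (t / 2))"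
proof
  fix x
  define h where "h = t / 2"
  have t: "t = 2 * h" and ch: "cos h \<noteq> 0" using t by (auto simp: h_def)
  have o: "b \<bullet> c = 0" "c \<bullet> b = 0" "b \<bullet> b = 1" "c \<bullet> c = 1" using assms by (auto simp: inner_Basis)
  define p q where "p = x \<bullet> b" and "q = x \<bullet> c"
  have pq: "x \<bullet> b = p" "x \<bullet> c = q" by (auto simp: p_def q_def)
  have T: "tan h * sin t = 1 - cos t"
    using ch by (simp add: t tan_def sin_double cos_double_sin power2_eq_square)
  have T2: "tan h * (cos t + 1) = sin t"
    using ch by (simp add: t tan_def sin_double cos_double_cos power2_eq_square)
  have E: "(shear b c (- tan (t / 2)) \<circ> shear c b (sin t) \<circ> shear b c (- tan (t / 2))) x
     = x + (- (tan h * q) - tan h * (q + sin t * (p - tan h * q))) *\<^sub>R b + (sin t * (p - tan h * q)) *\<^sub>R c"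
    by (simp add: shear_def inner_simps pq o h_def[symmetric] algebra_simps)
       (simp add: algebra_simps flip: scaleR_add_left)
  have 1: "sin t * (p - tan h * q) = (cos t - 1) * q + sin t * p"
  proof -
    have "sin t * (p - tan h * q) = sin t * p - (tan h * sin t) * q" by (simp add: algebra_simps)
    then show ?thesis unfolding T by (simp add: algebra_simps)
  qed
  have 2: "- (tan h * q) - tan h * (q + sin t * (p - tan h * q)) = (cos t - 1) * p - sin t * q"
  proof -
    have "- (tan h * q) - tan h * (q + sin t * (p - tan h * q))
       = - (tan h * (cos t + 1)) * q - (tan h * sin t) * p"
      unfolding 1 by (simp add: algebra_simps)
    then show ?thesis unfolding T T2 by (simp add: algebra_simps)
  qed
  show "rot b c t x = (shear b c (- tan (t / 2)) \<circ> shear c b (sin t) \<circ> shear b c (- tan (t / 2))) x"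
    unfolding E 2 unfolding 1 by (simp add: rot_def pq algebra_simps)
qed

lemma distr_lborel_rot:
  fixes b c :: "'a::euclidean_space"
  assumes b: "b \<in> Basis" and c: "c \<in> Basis" and bc: "b \<noteq> c" and t: "cos (t / 2) \<noteq> 0"
  shows "distr lborel borel (rot b c t) = lborel"
proof -
  let ?s = "shear b c (- tan (t / 2))" and ?u = "shear c b (sin t)"
  have "distr lborel borel (rot b c t) = distr (distr (distr lborel borel ?s) borel ?u) borel ?s"
    unfolding rot_eq_shears[OF assms] by (simp add: distr_distr comp_assoc)
  then show ?thesis using distr_lborel_shear[OF b c bc] distr_lborel_shear[OF c b bc[symmetric]] by simp
qed

section \<open>Integration over the sphere\<close>

abbreviation punctured_ball :: "'a::euclidean_space set" where
  "punctured_ball \<equiv> ball 0 1 - {0}"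

lemma unit_vector_continuous_on:
  "continuous_on (- {0}) (\<lambda>x::'a::euclidean_space. x /\<^sub>R norm x)"
  by (intro continuous_intros) auto

text \<open>The passage from the gauge integral to Lebesgue measure, where image measures can be
  used. The origin is cut out because \<open>x /\<^sub>R norm x\<close> is 0 there and off the
  sphere; elsewhere the extension along rays is continuous and bounded.\<close>

lemma sph_int_lborel:
  fixes h :: "real^'n::finite \<Rightarrow> complex"
  assumes h: "continuous_on (sphere 0 1) h"
  shows "integrable lborel (\<lambda>x. indicator punctured_ball x *\<^sub>R h (x /\<^sub>R norm x))"
    and "sph_int h = of_nat CARD('n) * (LINT x|lborel. indicator punctured_ball x *\<^sub>R h (x /\<^sub>R norm x))"
proof -
  have "bounded (h ` sphere 0 1)"
    by (rule compact_imp_bounded[OF compact_continuous_image[OF h compact_sphere]])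
  then obtain B where "\<forall>y\<in>h ` sphere 0 1. norm y \<le> B"
    unfolding bounded_iff by blast
  then have B: "norm (h x) \<le> B" if "x \<in> sphere 0 1" for x
    using that by blast
  let ?g = "\<lambda>x. indicator punctured_ball x *\<^sub>R h (x /\<^sub>R norm x)"
  have cont: "continuous_on punctured_ball (\<lambda>x. h (x /\<^sub>R norm x))"
    by (rule continuous_on_compose2[OF h continuous_on_subset[OF unit_vector_continuous_on]])
      (auto, metis left_inverse norm_eq_zero)
  have m: "?g \<in> borel_measurable lborel"
    using borel_measurable_continuous_on_indicator[OF _ cont] by simp
  show int: "integrable lborel ?g"
  proof (rule Bochner_Integration.integrable_bound[OF _ m])
    show "integrable lborel (\<lambda>x::real^'n. indicator (ball 0 1) x * B)"
      using emeasure_lborel_ball_finite[of 0 1]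
        by (intro integrable_mult_left integrable_real_indicator) auto
    show "AE x in lborel. norm (?g x) \<le> norm (indicator (ball 0 1) x * B)"
    proof (rule AE_I2)
      fix x :: "real^'n"
      have "norm (h (x /\<^sub>R norm x)) \<le> \<bar>B\<bar>" if "x \<noteq> 0"
        using B[of "x /\<^sub>R norm x"] that by simp
      then show "norm (?g x) \<le> norm (indicator (ball 0 1) x * B)"
        by (auto simp: indicator_def)
    qed
  qed
  have "integral (ball 0 1) (\<lambda>x. h (x /\<^sub>R norm x)) = integral UNIV (\<lambda>x. if x \<in> ball 0 1 then h (x /\<^sub>R norm x) else 0)"
    by (simp only: integral_restrict_UNIV)
  also have "\<dots> = integral UNIV ?g"
    by (rule integral_spike[of "{0}"]) (auto simp: indicator_def)
  also have "\<dots> = (LINT x|lborel. ?g x)" by (rule integral_lborel[OF int])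
  finally show "sph_int h = of_nat CARD('n) * (LINT x|lborel. ?g x)" by (simp add: sph_int_def)
qed

lemma sph_int_cong:
  fixes h g :: "real^'n::finite \<Rightarrow> complex"
  assumes "\<And>\<theta>. norm \<theta> = 1 \<Longrightarrow> h \<theta> = g \<theta>"
  shows "sph_int h = sph_int g"
  unfolding sph_int_def
  by (rule arg_cong[where f = "\<lambda>x. _ * x"], rule integral_spike[of "{0}"]) (auto intro!: assms[symmetric])

lemma sph_int_add:
  fixes h g :: "real^'n::finite \<Rightarrow> complex"
  assumes h: "continuous_on (sphere 0 1) h" and g: "continuous_on (sphere 0 1) g"
  shows "sph_int (\<lambda>\<theta>. h \<theta> + g \<theta>) = sph_int h + sph_int g"
  using Bochner_Integration.integral_add[OF sph_int_lborel(1)[OF h] sph_int_lborel(1)[OF g]]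
  by (simp add: sph_int_lborel(2)[OF h] sph_int_lborel(2)[OF g]
     sph_int_lborel(2)[OF continuous_on_add[OF h g]] scaleR_add_right distrib_left)

lemma sph_int_cmult:
  fixes h :: "real^'n::finite \<Rightarrow> complex"
  shows "sph_int (\<lambda>\<theta>. c * h \<theta>) = c * sph_int h"
  unfolding sph_int_def by simp

lemma sph_int_diff:
  fixes h g :: "real^'n::finite \<Rightarrow> complex"
  assumes h: "continuous_on (sphere 0 1) h" and g: "continuous_on (sphere 0 1) g"
  shows "sph_int (\<lambda>\<theta>. h \<theta> - g \<theta>) = sph_int h - sph_int g"
  using sph_int_add[OF h, of "\<lambda>\<theta>. -1 * g \<theta>"] g sph_int_cmult[of "-1" g]
  by (simp add: continuous_on_minus)

lemma sph_int_sum: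
  fixes h :: "'i \<Rightarrow> real^'n::finite \<Rightarrow> complex"
  assumes "finite I" "\<And>i. i \<in> I \<Longrightarrow> continuous_on (sphere 0 1) (h i)"
  shows "sph_int (\<lambda>\<theta>. \<Sum>i\<in>I. h i \<theta>) = (\<Sum>i\<in>I. sph_int (h i))"
  using assms
proof (induction I)
  case empty
  then show ?case by (simp add: sph_int_def)
next
  case (insert i I)
  then show ?case by (simp add: sph_int_add continuous_on_sum)
qed

lemma sph_int_bound:
  obtains C where "C > 0" and
    "\<And>(h :: real^'n::finite \<Rightarrow> complex) B. continuous_on (sphere 0 1) h \<Longrightarrow>
       (\<And>\<theta>. norm \<theta> = 1 \<Longrightarrow> norm (h \<theta>) \<le> B) \<Longrightarrow> norm (sph_int h) \<le> C * B"
proof -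
  let ?m = "measure lborel (ball 0 1 :: (real^'n) set)"
  have "norm (sph_int h) \<le> (CARD('n) * ?m + 1) * B"
    if h: "continuous_on (sphere 0 1) h" and B: "\<And>\<theta>. norm \<theta> = 1 \<Longrightarrow> norm (h \<theta>) \<le> B"
    for h :: "real^'n \<Rightarrow> complex" and B
  proof -
    \<comment> \<open>Some unit vector exists, so \<open>B\<close> is nonnegative. The
      \<open>+ 1\<close> makes the constant visibly positive.\<close>
    have "norm (axis undefined 1 :: real^'n) = 1" by (simp add: norm_axis_1)
    from B[OF this] have B0: "B \<ge> 0" by (meson norm_ge_zero order_trans)
    have "norm (LINT x|lborel. indicator punctured_ball x *\<^sub>R h (x /\<^sub>R norm x)) \<le> (LINT x|lborel. indicator (ball 0 1 :: (real^'n) set) x * B)"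
    proof (rule Bochner_Integration.integral_norm_bound_integral[OF sph_int_lborel(1)[OF h]])
      show "integrable lborel (\<lambda>x::real^'n. indicator (ball 0 1) x * B)"
        using emeasure_lborel_ball_finite[of 0 1]
        by (intro integrable_mult_left integrable_real_indicator) auto
      show "norm (indicator punctured_ball x *\<^sub>R h (x /\<^sub>R norm x)) \<le> indicator (ball 0 1) x * B" for x :: "real^'n"
      proof -
        have "norm (h (x /\<^sub>R norm x)) \<le> B" if "x \<noteq> 0"
          using B[of "x /\<^sub>R norm x"] that by simp
        then show ?thesis using B0 by (auto simp: indicator_def)
      qed
    qed
    also have "\<dots> = ?m * B" by simp
    finally have "norm (sph_int h) \<le> CARD('n) * (?m * B)"
      unfolding sph_int_lborel(2)[OF h] norm_mult by (simp add: mult_left_mono)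
    then show ?thesis using B0 by (simp add: algebra_simps)
  qed
  moreover have "CARD('n) * ?m + 1 > 0" by (simp add: add_nonneg_pos)
  ultimately show ?thesis using that by blast
qed

lemma continuous_on_rot: "continuous_on S (rot b c t)"
  unfolding rot_def by (intro continuous_intros)

text \<open>A rotation is linear and preserves norms, so it commutes with
  \<open>x /\<^sub>R norm x\<close> and respects membership in the punctured ball; what is left is
  the invariance of Lebesgue measure.\<close>

lemma sph_int_rot:
  fixes h :: "real^'n::finite \<Rightarrow> complex"
  assumes h: "continuous_on (sphere 0 1) h"
    and b: "b \<in> Basis" and c: "c \<in> Basis" and bc: "b \<noteq> c" and t: "cos (t / 2) \<noteq> 0"
  shows "sph_int (\<lambda>\<theta>. h (rot b c t \<theta>)) = sph_int h"
proof -
  let ?R = "rot b c t"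
  let ?g = "\<lambda>x. indicator punctured_ball x *\<^sub>R h (x /\<^sub>R norm x)"
  note nR = norm_rot[OF b c bc]
  have lin: "?R (s *\<^sub>R x) = s *\<^sub>R ?R x" for s x by (simp add: rot_def algebra_simps)
  have cR: "continuous_on (sphere 0 1) (\<lambda>\<theta>. h (?R \<theta>))"
    by (rule continuous_on_compose2[OF h]) (auto simp: nR intro: continuous_on_rot)
  have "(LINT x|lborel. ?g x) = (LINT x|distr lborel borel ?R. ?g x)"
    by (simp only: distr_lborel_rot[OF b c bc t])
  also have "\<dots> = (LINT x|lborel. ?g (?R x))"
    using borel_measurable_integrable[OF sph_int_lborel(1)[OF h]] by (intro integral_distr) auto
  also have "\<dots> = (LINT x|lborel. indicator punctured_ball x *\<^sub>R h (?R (x /\<^sub>R norm x)))"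
  proof (rule Bochner_Integration.integral_cong)
    fix x
    have "?R x = 0 \<longleftrightarrow> x = 0" using nR[of t x] by (metis norm_eq_zero)
    then show "?g (?R x) = indicator punctured_ball x *\<^sub>R h (?R (x /\<^sub>R norm x))"
      by (simp add: lin nR indicator_def)
  qed simp
  finally show ?thesis by (simp add: sph_int_lborel(2)[OF h] sph_int_lborel(2)[OF cR])
qed

text \<open>Uniform continuity of \<open>g'\<close> on a compact neighbourhood makes the difference quotients
  converge uniformly on the sphere.\<close>
lemma has_vector_derivative_sph_int:
  fixes g g' :: "real \<Rightarrow> real^'n::finite \<Rightarrow> complex"
  assumes T: "open T" "t0 \<in> T"
    and g: "\<And>t. t \<in> T \<Longrightarrow> continuous_on (sphere 0 1) (g t)"
    and g': "\<And>t \<theta>. t \<in> T \<Longrightarrow> norm \<theta> = 1 \<Longrightarrow> ((\<lambda>t. g t \<theta>) has_vector_derivative g' t \<theta>) (at t)"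
    and cont: "continuous_on (T \<times> sphere 0 1) (\<lambda>(t, \<theta>). g' t \<theta>)"
  shows "((\<lambda>t. sph_int (g t)) has_vector_derivative sph_int (g' t0)) (at t0)"
proof -
  obtain C where C: "C > 0" and bound:
    "\<And>(h :: real^'n \<Rightarrow> complex) B. continuous_on (sphere 0 1) h \<Longrightarrow>
       (\<And>\<theta>. norm \<theta> = 1 \<Longrightarrow> norm (h \<theta>) \<le> B) \<Longrightarrow> norm (sph_int h) \<le> C * B"
    using sph_int_bound[where 'n='n] by blast
  obtain d where d: "d > 0" "cball t0 d \<subseteq> T" using T open_contains_cball by blast
  have cg': "continuous_on (sphere 0 1) (g' t)" if "t \<in> T" for t
  proof -
    have "continuous_on (sphere 0 1) (\<lambda>\<theta>. (\<lambda>(t, \<theta>). g' t \<theta>) (t, \<theta>))"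
      by (rule continuous_on_compose2[OF cont]) (auto intro!: continuous_intros that)
    then show ?thesis by simp
  qed
  have uc: "uniformly_continuous_on (cball t0 d \<times> sphere 0 1) (\<lambda>(t, \<theta>). g' t \<theta>)"
    by (rule compact_uniformly_continuous[OF continuous_on_subset[OF cont]])
      (use d in \<open>auto intro!: compact_Times\<close>)
  have "\<exists>s>0. \<forall>t. norm (t - t0) < s \<longrightarrow>
      norm (sph_int (g t) - sph_int (g t0) - (t - t0) *\<^sub>R sph_int (g' t0)) \<le> e * norm (t - t0)"
    if e: "e > 0" for e
  proof -
    obtain s where s: "s > 0" and
      S: "\<And>p q. p \<in> cball t0 d \<times> sphere 0 1 \<Longrightarrow> q \<in> cball t0 d \<times> sphere 0 1 \<Longrightarrow> dist q p < s \<Longrightarrow>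
         dist ((\<lambda>(t, \<theta>). g' t \<theta>) q) ((\<lambda>(t, \<theta>). g' t \<theta>) p) < e / C"
      using uc e C unfolding uniformly_continuous_on_def by (metis divide_pos_pos)
    show ?thesis
    proof (intro exI[of _ "min s d"] conjI allI impI)
      fix t assume t: "norm (t - t0) < min s d"
      let ?h = "\<lambda>\<theta>. g t \<theta> - g t0 \<theta> - of_real (t - t0) * g' t0 \<theta>"
      have tT: "t \<in> T" using t d by (auto simp: dist_norm norm_minus_commute)
      have seg: "closed_segment t0 t \<subseteq> cball t0 (norm (t - t0))"
        by (rule closed_segment_subset) (auto simp: dist_norm norm_minus_commute)
      have "norm (?h \<theta>) \<le> norm (t - t0) * (e / C)" if \<theta>: "norm \<theta> = 1" for \<theta>
      proof -
        have "norm (g t \<theta> - g t0 \<theta> - (t - t0) *\<^sub>R g' t0 \<theta>) \<le> norm (t - t0) * (e / C)"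
        proof (rule vector_differentiable_bound_linearization[where f' = "\<lambda>t. g' t \<theta>" and S = "closed_segment t0 t"])
          fix x assume x: "x \<in> closed_segment t0 t"
          then have x': "dist t0 x \<le> norm (t - t0)" using seg by auto
          have xT: "x \<in> T" using x' t d by (auto simp: subset_iff)
          show "((\<lambda>t. g t \<theta>) has_vector_derivative g' x \<theta>) (at x within closed_segment t0 t)"
            using g'[OF xT \<theta>] by (rule has_vector_derivative_at_within)
          have "dist (x, \<theta>) (t0, \<theta>) < s" using x' t by (simp add: dist_Pair_Pair dist_commute)
          then show "norm (g' x \<theta> - g' t0 \<theta>) \<le> e / C"
            using S[of "(t0, \<theta>)" "(x, \<theta>)"] x' t d \<theta> by (simp add: dist_norm[of "g' x \<theta>"] less_imp_le)
        qed auto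
        then show ?thesis by (simp add: scaleR_conv_of_real)
      qed
      then have "norm (sph_int ?h) \<le> C * (norm (t - t0) * (e / C))"
        by (intro bound) (auto intro!: continuous_intros g cg' tT T)
      also have "sph_int ?h = sph_int (g t) - sph_int (g t0) - (t - t0) *\<^sub>R sph_int (g' t0)"
        using g[OF tT] g[OF T(2)] cg'[OF T(2)]
        by (simp add: sph_int_diff continuous_on_diff continuous_on_mult_left sph_int_cmult scaleR_conv_of_real del: of_real_diff)
      finally show "norm (sph_int (g t) - sph_int (g t0) - (t - t0) *\<^sub>R sph_int (g' t0)) \<le> e * norm (t - t0)"
        using C by (simp add: mult.commute)
    qed (use s d in auto)
  qed
  then show ?thesis
    unfolding has_vector_derivative_def has_derivative_within_alt
    by (auto simp: bounded_linear_scaleR_left)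
qed

section \<open>Continuously differentiable functions\<close>

text \<open>The mean value inequality for \<open>\<phi> t - t *\<^sub>R v\<close>. With
  \<open>v = 0\<close> it bounds an increment, with a reference derivative \<open>v\<close> the
  error of a linearisation.\<close>

lemma vector_derivative_linear_bound:
  fixes \<phi> :: "real \<Rightarrow> 'b::real_normed_vector"
  assumes S: "convex S" "a \<in> S" "b \<in> S"
    and \<phi>: "\<And>t. t \<in> S \<Longrightarrow> (\<phi> has_vector_derivative \<phi>' t) (at t)"
    and B: "\<And>t. t \<in> S \<Longrightarrow> norm (\<phi>' t - v) \<le> B"
  shows "norm (\<phi> b - \<phi> a - (b - a) *\<^sub>R v) \<le> B * \<bar>b - a\<bar>"
proof -
  have "norm ((\<phi> b - b *\<^sub>R v) - (\<phi> a - a *\<^sub>R v)) \<le> B * norm (b - a)"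
  proof (rule differentiable_bound[OF S(1) _ _ S(3,2)])
    fix t assume t: "t \<in> S"
    have "((\<lambda>t. \<phi> t - t *\<^sub>R v) has_vector_derivative (\<phi>' t - v)) (at t within S)"
      by (auto intro!: derivative_eq_intros has_vector_derivative_at_within[OF \<phi>[OF t]])
    then show "((\<lambda>t. \<phi> t - t *\<^sub>R v) has_derivative (\<lambda>h. h *\<^sub>R (\<phi>' t - v))) (at t within S)"
      by (simp add: has_vector_derivative_def)
    show "onorm (\<lambda>h. h *\<^sub>R (\<phi>' t - v)) \<le> B"
      using B[OF t] by (intro onorm_le) (simp add: mult.commute[of B] mult_left_mono)
  qed
  then show ?thesis by (simp add: algebra_simps)
qed

text \<open>The partial derivatives \<open>D\<close> are explicit data, so that the closure rules
  compute them symbolically; \<open>C1_on_pd\<close> leads back to \<open>pd\<close>. The total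
  derivative is demanded for the sake of the chain rule along arbitrary curves.\<close>

definition C1_on :: "(real^'n::finite) set \<Rightarrow> (real^'n \<Rightarrow> complex) \<Rightarrow> ('n \<Rightarrow> real^'n \<Rightarrow> complex) \<Rightarrow> bool" where
  "C1_on G g D \<longleftrightarrow> (\<forall>x\<in>G. (g has_derivative (\<lambda>h. \<Sum>i\<in>UNIV. of_real (h $ i) * D i x)) (at x))
     \<and> (\<forall>i. continuous_on G (D i))"

lemma C1_onD:
  assumes "C1_on G g D"
  shows "x \<in> G \<Longrightarrow> (g has_derivative (\<lambda>h. \<Sum>i\<in>UNIV. of_real (h $ i) * D i x)) (at x)"
    and "continuous_on G (D i)" and "continuous_on G g"
proof -
  show D: "(g has_derivative (\<lambda>h. \<Sum>i\<in>UNIV. of_real (h $ i) * D i x)) (at x)" if "x \<in> G" for x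
    using assms that by (simp add: C1_on_def)
  show "continuous_on G (D i)" using assms by (simp add: C1_on_def)
  show "continuous_on G g"
    by (rule continuous_at_imp_continuous_on) (blast intro: has_derivative_continuous D)
qed

lemma open_line_preimage:
  fixes x e :: "'a::real_normed_vector"
  shows "open G \<Longrightarrow> open {t::real. x + t *\<^sub>R e \<in> G}"
proof -
  assume "open G"
  then have "open ((\<lambda>t. x + t *\<^sub>R e) -` G)"
    by (rule open_vimage) (auto intro!: continuous_intros)
  then show ?thesis by (simp add: vimage_def)
qed

lemma has_vector_derivative_shift_line:
  fixes g :: "'a::real_normed_vector \<Rightarrow> 'b::real_normed_vector"
  assumes "((\<lambda>s. g (x + t *\<^sub>R e + s *\<^sub>R e)) has_vector_derivative D) (at 0)"
  shows "((\<lambda>s. g (x + s *\<^sub>R e)) has_vector_derivative D) (at t)"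
proof -
  have "((\<lambda>s::real. s - t) has_vector_derivative 1) (at t)"
    by (auto intro!: derivative_eq_intros)
  from vector_diff_chain_at[OF this, of "\<lambda>s. g (x + t *\<^sub>R e + s *\<^sub>R e)" D] assms
  show ?thesis by (simp add: o_def scaleR_diff_left)
qed

text \<open>Move from \<open>x\<close> to \<open>y\<close> one coordinate at a time.\<close>
lemma C1_on_partials:
  fixes g :: "real^'n::finite \<Rightarrow> complex"
  assumes G: "open G"
    and g: "\<And>i x. x \<in> G \<Longrightarrow> ((\<lambda>t. g (x + t *\<^sub>R axis i 1)) has_vector_derivative D i x) (at 0)"
    and D: "\<And>i. continuous_on G (D i)"
  shows "C1_on G g D"
  unfolding C1_on_def
proof (intro conjI ballI allI D)
  fix x assume x: "x \<in> G"
  have bl: "bounded_linear (\<lambda>h::real^'n. \<Sum>i\<in>UNIV. of_real (h $ i) * D i x)"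
    by (intro bounded_linear_sum bounded_linear_mult_left[THEN bounded_linear_compose]
      bounded_linear_of_real[THEN bounded_linear_compose] bounded_linear_vec_nth)
  have "\<exists>d>0. \<forall>y. norm (y - x) < d \<longrightarrow>
      norm (g y - g x - (\<Sum>i\<in>UNIV. of_real ((y - x) $ i) * D i x)) \<le> e * norm (y - x)"
    if e: "e > 0" for e
  proof -
    \<comment> \<open>Each of the \<open>CARD('n)\<close> coordinate moves may contribute an error
      \<open>e' * norm h\<close>.\<close>
    define e' where "e' = e / CARD('n)"
    have e': "e' > 0" using e by (simp add: e'_def)
    have "\<forall>\<^sub>F z in nhds x. z \<in> G" using G x by (rule eventually_nhds_in_open)
    moreover have "\<forall>\<^sub>F z in nhds x. \<forall>i. dist (D i z) (D i x) < e'"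
    proof (rule eventually_all_finite)
      fix i
      have "(D i \<longlongrightarrow> D i x) (nhds x)"
        using D[of i] G x by (metis continuous_on_eq_continuous_at continuous_at isCont_def tendsto_at_iff_tendsto_nhds)
      then show "\<forall>\<^sub>F z in nhds x. dist (D i z) (D i x) < e'" using e' by (rule tendstoD)
    qed
    ultimately have "\<forall>\<^sub>F z in nhds x. z \<in> G \<and> (\<forall>i. dist (D i z) (D i x) < e')"
      by eventually_elim auto
    then obtain d where d: "d > 0"
      and dG: "\<And>z. dist z x < d \<Longrightarrow> z \<in> G"
      and dD: "\<And>z i. dist z x < d \<Longrightarrow> dist (D i z) (D i x) < e'"
      unfolding eventually_nhds_metric by blast
    show ?thesis
    proof (intro exI[of _ d] conjI allI impI d)
      fix y assume y: "norm (y - x) < d"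
      define h where "h = y - x"
      \<comment> \<open>\<open>P I\<close> takes the coordinates in \<open>I\<close> from
        \<open>y\<close> and the others from \<open>x\<close>, so a set induction from
        \<open>{}\<close> to \<open>UNIV\<close> moves them one by one. The displacement from
        \<open>x\<close> never exceeds \<open>h\<close> in any coordinate, which keeps the path in
        the ball of radius \<open>d\<close>.\<close>
      define P where "P I = x + (\<Sum>i\<in>I. h $ i *\<^sub>R axis i 1)" for I
      have Pc: "(P I - x) $ j = (if j \<in> I then h $ j else 0)" for I j
        by (simp add: P_def axis_def if_distrib sum.delta cong: if_cong)
      have "norm (g (P I) - g x - (\<Sum>i\<in>I. of_real (h $ i) * D i x)) \<le> real (card I) * (e' * norm h)" for I
      proof (induction I rule: finite_induct[OF finite])
        case 1
        then show ?case by (simp add: P_def)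
      next
        case (2 j I)
        have P2: "P (insert j I) = P I + h $ j *\<^sub>R axis j 1" using 2 by (simp add: P_def algebra_simps)
        have near: "dist (P I + t *\<^sub>R axis j 1) x < d" if t: "t \<in> closed_segment 0 (h $ j)" for t
        proof -
          have "\<bar>t\<bar> \<le> \<bar>h $ j\<bar>" using segment_bound[OF t] by simp
          then have "norm (P I + t *\<^sub>R axis j 1 - x) \<le> norm h"
          proof (intro norm_le_componentwise_cart)
            fix i
            have "(P I + t *\<^sub>R axis j 1 - x) $ i = (P I - x) $ i + (if i = j then t else 0)"
              by (simp add: axis_def)
            then show "norm ((P I + t *\<^sub>R axis j 1 - x) $ i) \<le> norm (h $ i)"
              using 2 \<open>\<bar>t\<bar> \<le> \<bar>h $ j\<bar>\<close> by (simp only: Pc) auto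
          qed
          then show ?thesis using y by (simp add: dist_norm h_def)
        qed
        have "norm (g (P I + h $ j *\<^sub>R axis j 1) - g (P I + 0 *\<^sub>R axis j 1) - (h $ j - 0) *\<^sub>R D j x) \<le> e' * \<bar>h $ j - 0\<bar>"
        proof (rule vector_derivative_linear_bound[of "closed_segment 0 (h $ j)"])
          fix t assume t: "t \<in> closed_segment 0 (h $ j)"
          show "((\<lambda>s. g (P I + s *\<^sub>R axis j 1)) has_vector_derivative D j (P I + t *\<^sub>R axis j 1)) (at t)"
            by (rule has_vector_derivative_shift_line[OF g[OF dG[OF near[OF t]]]])
          show "norm (D j (P I + t *\<^sub>R axis j 1) - D j x) \<le> e'"
            using dD[OF near[OF t], of j] by (simp add: dist_norm)
        qed auto
        also have "\<dots> \<le> e' * norm h" using component_le_norm_cart[of h j] e' by simp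
        finally have "norm (g (P (insert j I)) - g (P I) - of_real (h $ j) * D j x) \<le> e' * norm h"
          by (simp add: P2 scaleR_conv_of_real)
        then have "norm ((g (P (insert j I)) - g (P I) - of_real (h $ j) * D j x)
            + (g (P I) - g x - (\<Sum>i\<in>I. of_real (h $ i) * D i x))) \<le> e' * norm h + real (card I) * (e' * norm h)"
          by (intro norm_triangle_mono 2)
        moreover have "(g (P (insert j I)) - g (P I) - of_real (h $ j) * D j x)
            + (g (P I) - g x - (\<Sum>i\<in>I. of_real (h $ i) * D i x))
            = g (P (insert j I)) - g x - (\<Sum>i\<in>insert j I. of_real (h $ i) * D i x)"
          using 2 by simp
        ultimately show ?case using 2 by (simp add: algebra_simps)
      qed
      from this[of UNIV]
      have "norm (g (P UNIV) - g x - (\<Sum>i\<in>UNIV. of_real (h $ i) * D i x)) \<le> e * norm h"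
        by (simp add: e'_def)
      moreover have "P UNIV = y"
        using Pc[of UNIV] by (simp add: vec_eq_iff h_def)
      ultimately show "norm (g y - g x - (\<Sum>i\<in>UNIV. of_real ((y - x) $ i) * D i x)) \<le> e * norm (y - x)"
        by (simp add: h_def)
    qed
  qed
  then show "(g has_derivative (\<lambda>h. \<Sum>i\<in>UNIV. of_real (h $ i) * D i x)) (at x)"
    unfolding has_derivative_within_alt using bl by auto
qed

lemma C1_on_axis:
  assumes "C1_on G g D" "x \<in> G"
  shows "((\<lambda>t. g (x + t *\<^sub>R axis i 1)) has_vector_derivative D i x) (at 0)"
proof -
  have "((\<lambda>t::real. x + t *\<^sub>R axis i 1) has_derivative (\<lambda>t. t *\<^sub>R axis i 1)) (at 0)"
    by (auto intro!: derivative_eq_intros)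
  from has_derivative_compose[OF this, of g "\<lambda>h. \<Sum>j\<in>UNIV. of_real (h $ j) * D j x"] C1_onD(1)[OF assms]
  have "((\<lambda>t. g (x + t *\<^sub>R axis i 1)) has_derivative (\<lambda>t. \<Sum>j\<in>UNIV. of_real ((t *\<^sub>R axis i 1) $ j) * D j x)) (at 0)"
    by simp
  moreover have "(\<Sum>j\<in>UNIV. of_real ((t *\<^sub>R axis i 1) $ j) * D j x) = t *\<^sub>R D i x" for t
  proof -
    have "(\<Sum>j\<in>UNIV. of_real ((t *\<^sub>R axis i 1) $ j) * D j x) = (\<Sum>j\<in>UNIV. if j = i then t *\<^sub>R D j x else 0)"
      by (intro sum.cong) (auto simp: axis_def scaleR_conv_of_real[where 'a=complex])
    then show ?thesis by simp
  qed
  ultimately show ?thesis by (simp add: has_vector_derivative_def)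
qed

lemma C1_on_pd:
  assumes "C1_on G g D" "x \<in> G"
  shows "pd i g x = D i x"
  unfolding pd_def by (rule vector_derivative_at[OF C1_on_axis[OF assms]])

lemma C1_on_const: "C1_on G (\<lambda>x. c) (\<lambda>i x. 0)"
  by (simp add: C1_on_def)

lemma C1_on_coord: "C1_on G (\<lambda>x. of_real (x $ j)) (\<lambda>i x. if i = j then 1 else 0)"
proof -
  have "((\<lambda>x::real^'a. of_real (x $ j) :: complex) has_derivative (\<lambda>h. of_real (h $ j))) (at x)" for x
    by (intro bounded_linear_imp_has_derivative bounded_linear_of_real[THEN bounded_linear_compose] bounded_linear_vec_nth)
  then show ?thesis by (simp add: C1_on_def if_distrib[of "\<lambda>x. _ * x"] sum.delta cong: if_cong)
qed

lemma C1_on_add: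
  assumes "C1_on G g D" "C1_on G h E"
  shows "C1_on G (\<lambda>x. g x + h x) (\<lambda>i x. D i x + E i x)"
  unfolding C1_on_def
proof (intro conjI ballI allI continuous_on_add C1_onD(2)[OF assms(1)] C1_onD(2)[OF assms(2)])
  fix x assume x: "x \<in> G"
  show "((\<lambda>x. g x + h x) has_derivative (\<lambda>h. \<Sum>i\<in>UNIV. of_real (h $ i) * (D i x + E i x))) (at x)"
    using has_derivative_add[OF C1_onD(1)[OF assms(1) x] C1_onD(1)[OF assms(2) x]]
    by (simp add: distrib_left sum.distrib)
qed

lemma C1_on_mult:
  assumes "C1_on G g D" "C1_on G h E"
  shows "C1_on G (\<lambda>x. g x * h x) (\<lambda>i x. g x * E i x + D i x * h x)"
  unfolding C1_on_def
proof (intro conjI ballI allI continuous_on_add continuous_on_mult C1_onD(2,3)[OF assms(1)] C1_onD(2,3)[OF assms(2)])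
  fix x assume x: "x \<in> G"
  have "(\<lambda>v. g x * (\<Sum>i\<in>UNIV. of_real (v $ i) * E i x) + (\<Sum>i\<in>UNIV. of_real (v $ i) * D i x) * h x)
     = (\<lambda>v. \<Sum>i\<in>UNIV. of_real (v $ i) * (g x * E i x + D i x * h x))"
    by (simp add: sum_distrib_left sum_distrib_right distrib_left sum.distrib algebra_simps)
  then show "((\<lambda>x. g x * h x) has_derivative (\<lambda>v. \<Sum>i\<in>UNIV. of_real (v $ i) * (g x * E i x + D i x * h x))) (at x)"
    using has_derivative_mult[OF C1_onD(1)[OF assms(1) x] C1_onD(1)[OF assms(2) x]] by simp
qed

lemma C1_on_sum:
  assumes "finite I" "\<And>k. k \<in> I \<Longrightarrow> C1_on G (g k) (D k)"
  shows "C1_on G (\<lambda>x. \<Sum>k\<in>I. g k x) (\<lambda>i x. \<Sum>k\<in>I. D k i x)"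
  using assms by (induction I) (auto intro: C1_on_const C1_on_add)

lemma C1_on_diff:
  assumes "C1_on G g D" "C1_on G h E"
  shows "C1_on G (\<lambda>x. g x - h x) (\<lambda>i x. D i x - E i x)"
  using C1_on_add[OF assms(1) C1_on_mult[OF C1_on_const[of G "-1"] assms(2)]] by simp

lemma C1_on_subset: "C1_on G g D \<Longrightarrow> H \<subseteq> G \<Longrightarrow> C1_on H g D"
  unfolding C1_on_def by (auto intro: continuous_on_subset)

lemma C1_on_vector_derivative:
  assumes "C1_on G g D" "\<gamma> t \<in> G" and \<gamma>: "(\<gamma> has_vector_derivative v) (at t)"
  shows "((\<lambda>t. g (\<gamma> t)) has_vector_derivative (\<Sum>i\<in>UNIV. of_real (v $ i) * D i (\<gamma> t))) (at t)"
  using has_derivative_compose[OF \<gamma>[unfolded has_vector_derivative_def] C1_onD(1)[OF assms(1,2)]]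
  by (simp add: has_vector_derivative_def scaleR_sum_right scaleR_conv_of_real[where 'a=complex] mult.assoc sum_distrib_left)

section \<open>Iterated partial derivatives, smoothness and powers of the Laplacian\<close>

lemma pd_cong:
  assumes G: "open G" and x: "x \<in> G" and eq: "\<And>x. x \<in> G \<Longrightarrow> f x = g x"
  shows "pd i f x = pd i g x"
  unfolding pd_def
proof (rule vector_derivative_cong_eq)
  have "\<forall>\<^sub>F t::real in nhds 0. t \<in> {t. x + t *\<^sub>R axis i 1 \<in> G}"
    using x by (intro eventually_nhds_in_open open_line_preimage G) auto
  then show "\<forall>\<^sub>F t in nhds 0. t \<in> UNIV \<longrightarrow> f (x + t *\<^sub>R axis i 1) = g (x + t *\<^sub>R axis i 1)"
    by eventually_elim (simp add: eq)
qed auto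

lemma pds_append: "pds (is @ js) f = pds is (pds js f)"
  by (induction "is") simp_all

text \<open>\<open>smooth_on\<close> speaks only of derivatives along the axes; as all iterated ones
  are continuous, each of them is totally differentiable.\<close>

lemma smooth_on_C1_on_pds:
  assumes G: "open G" and f: "smooth_on G f"
  shows "C1_on G (pds is f) (\<lambda>i. pds (i # is) f)"
proof (rule C1_on_partials[OF G])
  show "((\<lambda>t. pds is f (x + t *\<^sub>R axis i 1)) has_vector_derivative pds (i # is) f x) (at 0)" if "x \<in> G" for i x
    using f that by (simp add: smooth_on_def pd_def vector_derivative_works)
  show "continuous_on G (pds (i # is) f)" for i
    using f unfolding smooth_on_def by blast
qed

lemma smooth_onI_C1_on:
  assumes "\<And>is. C1_on G (pds is f) (\<lambda>i. pds (i # is) f)"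
  shows "smooth_on G f"
  unfolding smooth_on_def
proof (intro allI conjI ballI)
  fix "is"
  show "continuous_on G (pds is f)" by (rule C1_onD(3)[OF assms])
  show "(\<lambda>t. pds is f (x + t *\<^sub>R axis i 1)) differentiable at 0" if "x \<in> G" for i x
    by (rule differentiableI_vector[OF C1_on_axis[OF assms that]])
qed

lemma smooth_on_pd:
  assumes G: "open G" and f: "smooth_on G f"
  shows "smooth_on G (pd i f)"
proof (rule smooth_onI_C1_on)
  have "pds is (pd i f) = pds (is @ [i]) f" for "is" by (simp add: pds_append)
  then show "C1_on G (pds is (pd i f)) (\<lambda>j. pds (j # is) (pd i f))" for "is"
    using smooth_on_C1_on_pds[OF G f, of "is @ [i]"] by simp
qed

lemma C1_on_cong:
  assumes G: "open G" and g: "C1_on G g D"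
    and "\<And>x. x \<in> G \<Longrightarrow> h x = g x" "\<And>i x. x \<in> G \<Longrightarrow> E i x = D i x"
  shows "C1_on G h E"
proof -
  have "(h has_derivative (\<lambda>v. \<Sum>i\<in>UNIV. of_real (v $ i) * E i x)) (at x)" if x: "x \<in> G" for x
    using has_derivative_transform_within_open[OF C1_onD(1)[OF g x] G x, of h] assms x by simp
  moreover have "continuous_on G (E i)" for i
    using C1_onD(2)[OF g] assms(4) by (metis continuous_on_cong)
  ultimately show ?thesis by (simp add: C1_on_def)
qed

lemma pds_sum:
  assumes G: "open G" and I: "finite I" and f: "\<And>k. k \<in> I \<Longrightarrow> smooth_on G (f k)" and x: "x \<in> G"
  shows "pds is (\<lambda>x. \<Sum>k\<in>I. f k x) x = (\<Sum>k\<in>I. pds is (f k) x)"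
  using x
proof (induction "is" arbitrary: x)
  case (Cons i "is")
  have "pd i (pds is (\<lambda>x. \<Sum>k\<in>I. f k x)) x = pd i (\<lambda>x. \<Sum>k\<in>I. pds is (f k) x) x"
    using Cons by (intro pd_cong[OF G]) auto
  also have "\<dots> = (\<Sum>k\<in>I. pds (i # is) (f k) x)"
    using C1_on_sum[OF I smooth_on_C1_on_pds[OF G f, of _ "is"]] Cons.prems by (rule C1_on_pd)
  finally show ?case by simp
qed simp

lemma smooth_on_sum:
  assumes G: "open G" and I: "finite I" and f: "\<And>k. k \<in> I \<Longrightarrow> smooth_on G (f k)"
  shows "smooth_on G (\<lambda>x. \<Sum>k\<in>I. f k x)"
proof (rule smooth_onI_C1_on)
  show "C1_on G (pds is (\<lambda>x. \<Sum>k\<in>I. f k x)) (\<lambda>i. pds (i # is) (\<lambda>x. \<Sum>k\<in>I. f k x))" for "is"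
  proof (rule C1_on_cong[OF G])
    show "C1_on G (\<lambda>x. \<Sum>k\<in>I. pds is (f k) x) (\<lambda>i x. \<Sum>k\<in>I. pds (i # is) (f k) x)"
      by (rule C1_on_sum[OF I smooth_on_C1_on_pds[OF G f]])
  qed (rule pds_sum[OF G I f]; assumption)+
qed

lemma smooth_on_lap: "open G \<Longrightarrow> smooth_on G f \<Longrightarrow> smooth_on G (lap f)"
  unfolding lap_def[abs_def] by (intro smooth_on_sum smooth_on_pd) auto

lemma smooth_on_lap_pow: "open G \<Longrightarrow> smooth_on G f \<Longrightarrow> smooth_on G ((lap ^^ p) f)"
  by (induction p) (auto intro: smooth_on_lap)

lemma smooth_on_C1_on: "open G \<Longrightarrow> smooth_on G f \<Longrightarrow> C1_on G f (\<lambda>i. pd i f)"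
  using smooth_on_C1_on_pds[of G f "[]"] by simp

text \<open>With an inductive class instead of multi-index sums, stability under \<open>pd\<close>
  and \<open>cnj\<close> is a rule induction.\<close>

inductive polyfun :: "(real^'n::finite \<Rightarrow> complex) \<Rightarrow> bool" where
  const: "polyfun (\<lambda>x. c)"
| coord: "polyfun (\<lambda>x. of_real (x $ i))"
| add: "polyfun f \<Longrightarrow> polyfun g \<Longrightarrow> polyfun (\<lambda>x. f x + g x)"
| mult: "polyfun f \<Longrightarrow> polyfun g \<Longrightarrow> polyfun (\<lambda>x. f x * g x)"

lemma polyfun_sum: "(\<And>k. k \<in> I \<Longrightarrow> polyfun (f k)) \<Longrightarrow> polyfun (\<lambda>x. \<Sum>k\<in>I. f k x)"
  by (induction I rule: infinite_finite_induct) (simp_all add: polyfun.const polyfun.add)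

lemma polyfun_prod: "(\<And>k. k \<in> I \<Longrightarrow> polyfun (f k)) \<Longrightarrow> polyfun (\<lambda>x. \<Prod>k\<in>I. f k x)"
  by (induction I rule: infinite_finite_induct) (simp_all add: polyfun.const polyfun.mult)

lemma polyfun_power: "polyfun f \<Longrightarrow> polyfun (\<lambda>x. f x ^ m)"
  by (induction m) (simp_all add: polyfun.const polyfun.mult)

lemma polyfun_cnj: "polyfun f \<Longrightarrow> polyfun (\<lambda>x. cnj (f x))"
  by (induction rule: polyfun.induct) (simp_all add: polyfun.intros)

lemma polyfun_derivs:
  assumes "polyfun f"
  shows "\<exists>D. C1_on UNIV f D \<and> (\<forall>i. polyfun (D i))"
  using assms
proof (induction rule: polyfun.induct)
  case (const c)
  then show ?case using C1_on_const polyfun.const by blast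
next
  case (coord j)
  have "polyfun (\<lambda>x. if i = j then 1 else 0)" for i :: 'a
    by (cases "i = j") (auto intro: polyfun.const)
  then show ?case using C1_on_coord by blast
next
  case (add f g)
  then show ?case using C1_on_add by (blast intro: polyfun.add)
next
  case (mult f g)
  then obtain D E where D: "C1_on UNIV f D" "\<And>i. polyfun (D i)" and E: "C1_on UNIV g E" "\<And>i. polyfun (E i)"
    by blast
  show ?case
    by (intro exI[of _ "\<lambda>i x. f x * E i x + D i x * g x"] conjI allI C1_on_mult D E polyfun.add polyfun.mult mult.hyps)
qed

lemma polyfun_pd:
  assumes "polyfun f"
  shows "polyfun (pd i f)" and "C1_on UNIV f (\<lambda>i. pd i f)"
proof -
  obtain D where D: "C1_on UNIV f D" "\<And>i. polyfun (D i)" using polyfun_derivs[OF assms] by blast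
  have "pd i f = D i" for i using C1_on_pd[OF D(1)] by (intro ext) simp
  then show "polyfun (pd i f)" "C1_on UNIV f (\<lambda>i. pd i f)" using D by simp_all
qed

text \<open>\<open>fcoef\<close> integrates against the conjugate of the spherical harmonic, so the
  conjugate is the weight in Green's identity. Conjugation commutes with derivatives in real
  variables, hence preserves harmonicity.\<close>

lemma hom_harm_poly_cnj:
  assumes "hom_harm_poly k P"
  shows "polyfun (\<lambda>x. cnj (P x))"
    and "P (t *\<^sub>R x) = of_real t ^ k * P x"
    and "lap (\<lambda>x. cnj (P x)) x = 0"
proof -
  obtain c where "\<forall>x. P x = (\<Sum>\<alpha>\<in>{\<alpha>. (\<Sum>i\<in>UNIV. \<alpha> i) = k}. c \<alpha> * of_real (\<Prod>i\<in>UNIV. (x $ i) ^ \<alpha> i))"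
    and lap: "\<forall>x. lap P x = 0"
    using assms unfolding hom_harm_poly_def by (elim conjE exE)
  then have P: "P x = (\<Sum>\<alpha>\<in>{\<alpha>. (\<Sum>i\<in>UNIV. \<alpha> i) = k}. c \<alpha> * of_real (\<Prod>i\<in>UNIV. (x $ i) ^ \<alpha> i))" for x
    by simp
  have poly: "polyfun P"
    unfolding P[abs_def] of_real_prod of_real_power
    by (intro polyfun_sum polyfun.mult polyfun.const polyfun_prod polyfun_power polyfun.coord)
  then show "polyfun (\<lambda>x. cnj (P x))" by (rule polyfun_cnj)
  have "(\<Prod>i\<in>UNIV. ((t *\<^sub>R x) $ i) ^ \<alpha> i) = t ^ k * (\<Prod>i\<in>UNIV. (x $ i) ^ \<alpha> i)"
    if "(\<Sum>i\<in>UNIV. \<alpha> i) = k" for \<alpha> :: "'a \<Rightarrow> nat"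
    using that by (simp add: power_mult_distrib prod.distrib power_sum[symmetric])
  then show "P (t *\<^sub>R x) = of_real t ^ k * P x"
    unfolding P by (auto simp: sum_distrib_left intro!: sum.cong)
  have cnj: "pd i (\<lambda>x. cnj (g x)) = (\<lambda>x. cnj (pd i g x))" if "polyfun g" for g :: "real^'a \<Rightarrow> complex" and i
    unfolding pd_def[of i "\<lambda>x. cnj (g x)"]
    by (intro ext vector_derivative_at has_vector_derivative_cnj C1_on_axis[OF polyfun_pd(2)[OF that]]) simp
  have "lap (\<lambda>x. cnj (P x)) x = cnj (lap P x)"
    unfolding lap_def by (simp add: cnj poly polyfun_pd(1))
  then show "lap (\<lambda>x. cnj (P x)) x = 0" by (simp add: lap)
qed

section \<open>Green's identity on the sphere\<close>

lemma has_vector_derivative_rot: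
  "((\<lambda>t. rot b c t x) has_vector_derivative
     (- sin t) *\<^sub>R ((x \<bullet> b) *\<^sub>R b + (x \<bullet> c) *\<^sub>R c) + cos t *\<^sub>R ((x \<bullet> b) *\<^sub>R c - (x \<bullet> c) *\<^sub>R b)) (at t)"
  unfolding rot_def
  by (rule derivative_eq_intros refl | simp)+

text \<open>The integral of \<open>\<psi> (r *\<^sub>R \<theta>)\<close> does not change when
  \<open>\<theta>\<close> is rotated in the plane of the axes \<open>i\<close> and \<open>j\<close>;
  its derivative in the angle at 0 is the integral of the rotation field applied to
  \<open>\<psi>\<close>. Constancy is available on \<open>{-pi<..<pi}\<close>, where
  \<open>cos (t / 2)\<close> is positive.\<close>

lemma sph_int_rotation_field:
  fixes \<psi> :: "real^'n::finite \<Rightarrow> complex"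
  assumes \<psi>: "C1_on G \<psi> D" and G: "\<And>\<theta>. norm \<theta> = 1 \<Longrightarrow> r *\<^sub>R \<theta> \<in> G"
  shows "sph_int (\<lambda>\<theta>. of_real ((r *\<^sub>R \<theta>) $ i) * D j (r *\<^sub>R \<theta>) - of_real ((r *\<^sub>R \<theta>) $ j) * D i (r *\<^sub>R \<theta>)) = 0"
proof (cases "i = j")
  case True
  then show ?thesis by (simp add: sph_int_def)
next
  case False
  define b c :: "real^'n" where "b = axis i 1" and "c = axis j 1"
  have bc: "b \<in> Basis" "c \<in> Basis" "b \<noteq> c"
    using False by (auto simp: b_def c_def axis_in_Basis_iff axis_eq_axis)
  define R where "R t x = r *\<^sub>R rot b c t x" for t and x :: "real^'n"
  define R' where "R' t x = r *\<^sub>R ((- sin t) *\<^sub>R ((x \<bullet> b) *\<^sub>R b + (x \<bullet> c) *\<^sub>R c)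
      + cos t *\<^sub>R ((x \<bullet> b) *\<^sub>R c - (x \<bullet> c) *\<^sub>R b))" for t and x :: "real^'n"
  define g where "g t \<theta> = \<psi> (R t \<theta>)" for t \<theta>
  define g' where "g' t \<theta> = (\<Sum>m\<in>UNIV. of_real (R' t \<theta> $ m) * D m (R t \<theta>))" for t \<theta>
  have RG: "R t \<theta> \<in> G" if "norm \<theta> = 1" for t \<theta>
    unfolding R_def by (rule G) (simp add: norm_rot[OF bc] that)
  have cR: "continuous_on S (\<lambda>(t, \<theta>). R t \<theta>)" for S
    unfolding R_def rot_def case_prod_unfold by (intro continuous_intros)
  have cR': "continuous_on S (\<lambda>(t, \<theta>). R' t \<theta>)" for S
    unfolding R'_def case_prod_unfold by (intro continuous_intros)
  have cpsi: "continuous_on (sphere 0 1) (\<lambda>\<theta>. \<psi> (r *\<^sub>R \<theta>))"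
    by (rule continuous_on_compose2[OF C1_onD(3)[OF \<psi>]]) (auto intro!: continuous_intros G)
  have deriv: "((\<lambda>t. sph_int (g t)) has_vector_derivative sph_int (g' 0)) (at 0)"
  proof (rule has_vector_derivative_sph_int[of UNIV])
    show "continuous_on (sphere 0 1) (g t)" for t
      unfolding g_def R_def
      by (rule continuous_on_compose2[OF C1_onD(3)[OF \<psi>]])
        (use RG in \<open>auto simp: R_def intro!: continuous_intros continuous_on_rot\<close>)
    show "((\<lambda>t. g t \<theta>) has_vector_derivative g' t \<theta>) (at t)" if "norm \<theta> = 1" for t \<theta>
      unfolding g_def g'_def
    proof (rule C1_on_vector_derivative[OF \<psi> RG[OF that]])
      show "((\<lambda>t. R t \<theta>) has_vector_derivative R' t \<theta>) (at t)"
        unfolding R_def R'_def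
        by (rule bounded_linear.has_vector_derivative[OF bounded_linear_scaleR_right has_vector_derivative_rot])
    qed
    have "continuous_on (UNIV \<times> sphere 0 1) (\<lambda>p. D m ((\<lambda>(t, \<theta>). R t \<theta>) p))" for m
      by (rule continuous_on_compose2[OF C1_onD(2)[OF \<psi>] cR]) (auto intro: RG)
    moreover have "continuous_on (UNIV \<times> sphere 0 1) (\<lambda>p. complex_of_real ((\<lambda>(t, \<theta>). R' t \<theta>) p $ m))" for m
      by (intro continuous_intros cR')
    ultimately show "continuous_on (UNIV \<times> sphere 0 1) (\<lambda>(t, \<theta>). g' t \<theta>)"
      unfolding g'_def case_prod_unfold by (intro continuous_on_sum continuous_on_mult) auto
  qed auto
  have const: "sph_int (\<lambda>\<theta>. \<psi> (r *\<^sub>R \<theta>)) = sph_int (g t)" if "t \<in> {-pi<..<pi}" for t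
  proof -
    have "cos (t / 2) > 0" using that by (intro cos_gt_zero_pi) auto
    then show ?thesis unfolding g_def R_def using sph_int_rot[OF cpsi bc, of t] by simp
  qed
  have "((\<lambda>t. sph_int (g t)) has_vector_derivative 0) (at 0)"
    by (rule has_vector_derivative_transform_within_open[OF has_vector_derivative_const[of "sph_int (\<lambda>\<theta>. \<psi> (r *\<^sub>R \<theta>))"], of "{-pi<..<pi}"])
      (auto intro: const)
  then have "sph_int (g' 0) = 0" using deriv vector_derivative_unique_at by blast
  moreover have "g' 0 = (\<lambda>\<theta>. of_real ((r *\<^sub>R \<theta>) $ i) * D j (r *\<^sub>R \<theta>) - of_real ((r *\<^sub>R \<theta>) $ j) * D i (r *\<^sub>R \<theta>))"
  proof
    fix \<theta>
    have RR: "R' 0 \<theta> $ m = (if m = j then r * \<theta> $ i else 0) - (if m = i then r * \<theta> $ j else 0)" for m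
    proof -
      have "\<theta> \<bullet> b = \<theta> $ i" "\<theta> \<bullet> c = \<theta> $ j" by (simp_all add: b_def c_def inner_axis)
      moreover have "b $ m = (if m = i then 1 else 0)" "c $ m = (if m = j then 1 else 0)"
        by (simp_all add: b_def c_def axis_def)
      ultimately show ?thesis by (simp add: R'_def)
    qed
    have R0: "R 0 \<theta> = r *\<^sub>R \<theta>" by (simp add: R_def rot_def)
    have "g' 0 \<theta> = (\<Sum>m\<in>UNIV. (if m = j then of_real (r * \<theta> $ i) * D m (r *\<^sub>R \<theta>) else 0)
        - (if m = i then of_real (r * \<theta> $ j) * D m (r *\<^sub>R \<theta>) else 0))"
      unfolding g'_def RR R0 using False by (intro sum.cong) auto
    then show "g' 0 \<theta> = of_real ((r *\<^sub>R \<theta>) $ i) * D j (r *\<^sub>R \<theta>) - of_real ((r *\<^sub>R \<theta>) $ j) * D i (r *\<^sub>R \<theta>)"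
      by (simp add: sum_subtractf)
  qed
  ultimately show ?thesis by simp
qed

text \<open>The identity is the vanishing on the sphere of the sum over \<open>i, j\<close> of the rotation fields
  \<open>x\<^sub>i \<partial>\<^sub>j - x\<^sub>j \<partial>\<^sub>i\<close> applied to \<open>x\<^sub>i F\<^sub>j\<close>, where \<open>F = Q \<nabla>u - u \<nabla>Q\<close>; it replaces the
  self-adjointness of the spherical Laplacian.\<close>
lemma sph_int_green:
  fixes u Q :: "real^'n::finite \<Rightarrow> complex"
  assumes u: "C1_on G u U" "\<And>i. C1_on G (U i) (UU i)"
    and Q: "C1_on G Q V" "\<And>i. C1_on G (V i) (VV i)"
    and G: "\<And>\<theta>. norm \<theta> = 1 \<Longrightarrow> r *\<^sub>R \<theta> \<in> G"
    and harm: "\<And>x. x \<in> G \<Longrightarrow> (\<Sum>i\<in>UNIV. VV i i x) = 0"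
    and eul: "\<And>x. x \<in> G \<Longrightarrow> (\<Sum>i\<in>UNIV. of_real (x $ i) * V i x) = of_nat k * Q x"
    and eul2: "\<And>x. x \<in> G \<Longrightarrow> (\<Sum>i\<in>UNIV. \<Sum>j\<in>UNIV. of_real (x $ i) * of_real (x $ j) * VV j i x)
        = (of_nat k ^ 2 - of_nat k) * Q x"
  defines "Eu \<equiv> \<lambda>x. \<Sum>i\<in>UNIV. of_real (x $ i) * U i x"
    and "EEu \<equiv> \<lambda>x. (\<Sum>i\<in>UNIV. of_real (x $ i) * U i x)
        + (\<Sum>i\<in>UNIV. \<Sum>j\<in>UNIV. of_real (x $ i) * of_real (x $ j) * UU j i x)"
  shows "sph_int (\<lambda>\<theta>. (\<lambda>x. Q x * (of_real (r\<^sup>2) * (\<Sum>i\<in>UNIV. UU i i x) + (2 - of_nat CARD('n)) * Eu x - EEu x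
      + of_nat k * (of_nat k + of_nat CARD('n) - 2) * u x)) (r *\<^sub>R \<theta>)) = 0"
proof -
  define F where "F j x = Q x * U j x - u x * V j x" for j x
  \<comment> \<open>\<open>DF j m\<close> is the partial derivative of \<open>F j\<close> in
    \<open>x_m\<close>, \<open>D i j m\<close> that of \<open>x_i F_j\<close>, and
    \<open>L i j\<close> is the rotation field of the axes \<open>i\<close>, \<open>j\<close>
    applied to \<open>x_i F_j\<close>.\<close>
  define DF where "DF j m x = (Q x * UU j m x + V m x * U j x) - (u x * VV j m x + U m x * V j x)" for j m x
  define D where "D i j m x = of_real (x $ i) * DF j m x + (if m = i then 1 else 0) * F j x" for i j m x
  define L where "L i j x = of_real (x $ i) * D i j j x - of_real (x $ j) * D i j i x" for i j and x :: "real^'n"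
  have C: "C1_on G (\<lambda>x. of_real (x $ i) * F j x) (D i j)" for i j
    unfolding D_def F_def DF_def by (intro C1_on_mult C1_on_coord C1_on_diff u Q)
  have sph: "continuous_on (sphere 0 1) (\<lambda>\<theta>. h (r *\<^sub>R \<theta>))" if "continuous_on G h" for h :: "real^'n \<Rightarrow> complex"
    by (rule continuous_on_compose2[OF that]) (auto intro!: continuous_intros G)
  have "continuous_on G (L i j)" for i j
    unfolding L_def by (intro continuous_intros C1_onD(2)[OF C])
  then have Lc: "continuous_on (sphere 0 1) (\<lambda>\<theta>. L i j (r *\<^sub>R \<theta>))" for i j
    by (rule sph)
  have "sph_int (\<lambda>\<theta>. \<Sum>i\<in>UNIV. \<Sum>j\<in>UNIV. L i j (r *\<^sub>R \<theta>)) = 0"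
    using sph_int_rotation_field[OF C G]
    by (simp add: sph_int_sum continuous_on_sum Lc) (simp add: L_def)
  also have "sph_int (\<lambda>\<theta>. \<Sum>i\<in>UNIV. \<Sum>j\<in>UNIV. L i j (r *\<^sub>R \<theta>)) =
    sph_int (\<lambda>\<theta>. (\<lambda>x. Q x * (of_real (r\<^sup>2) * (\<Sum>i\<in>UNIV. UU i i x) + (2 - of_nat CARD('n)) * Eu x - EEu x
      + of_nat k * (of_nat k + of_nat CARD('n) - 2) * u x)) (r *\<^sub>R \<theta>))"
  proof (rule sph_int_cong)
    fix \<theta> :: "real^'n" assume \<theta>: "norm \<theta> = 1"
    define x where "x = r *\<^sub>R \<theta>"
    define X where "X i = complex_of_real (x $ i)" for i
    have xG: "x \<in> G" using G[OF \<theta>] by (simp add: x_def)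
    have r2: "(\<Sum>i\<in>UNIV. X i * X i) = of_real (r\<^sup>2)"
    proof -
      have "(\<Sum>i\<in>UNIV. \<theta> $ i * \<theta> $ i) = 1" using \<theta> by (simp add: norm_eq_1 inner_vec_def)
      moreover have "(\<Sum>i\<in>UNIV. x $ i * x $ i) = r\<^sup>2 * (\<Sum>i\<in>UNIV. \<theta> $ i * \<theta> $ i)"
        unfolding sum_distrib_left x_def by (intro sum.cong refl) (simp add: power2_eq_square)
      moreover have "(\<Sum>i\<in>UNIV. X i * X i) = of_real (\<Sum>i\<in>UNIV. x $ i * x $ i)"
        by (simp add: X_def)
      ultimately show ?thesis by simp
    qed
    define n where "n = complex_of_nat CARD('n)"
    define K where "K = complex_of_nat k"
    define S where "S = (\<Sum>i\<in>UNIV. \<Sum>j\<in>UNIV. X i * X j * UU j i x)"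
    have e1: "(\<Sum>i\<in>UNIV. X i * V i x) = K * Q x" using eul[OF xG] by (simp add: X_def K_def)
    have e2: "(\<Sum>i\<in>UNIV. \<Sum>j\<in>UNIV. X i * X j * VV j i x) = (K^2 - K) * Q x"
      using eul2[OF xG] by (simp add: X_def K_def)
    have Eu: "(\<Sum>i\<in>UNIV. X i * U i x) = Eu x" by (simp add: Eu_def X_def)
    have EEu: "EEu x = Eu x + S" by (simp add: EEu_def Eu_def X_def S_def)
    have xF: "(\<Sum>j\<in>UNIV. X j * F j x) = Q x * Eu x - u x * (K * Q x)"
      unfolding F_def e1[symmetric] Eu[symmetric]
      by (simp add: right_diff_distrib sum_subtractf sum_distrib_left mult.left_commute)
    have divF: "(\<Sum>j\<in>UNIV. DF j j x) = Q x * (\<Sum>i\<in>UNIV. UU i i x)"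
    proof -
      have "(\<Sum>j\<in>UNIV. DF j j x) = (\<Sum>j\<in>UNIV. Q x * UU j j x - u x * VV j j x)"
        unfolding DF_def by (simp add: mult.commute)
      also have "\<dots> = Q x * (\<Sum>i\<in>UNIV. UU i i x) - u x * (\<Sum>i\<in>UNIV. VV i i x)"
        by (simp add: sum_subtractf sum_distrib_left)
      finally show ?thesis using harm[OF xG] by simp
    qed
    \<comment> \<open>The products of a first derivative of \<open>u\<close> with one of
      \<open>Q\<close> cancel: both double sums factor into the same product of Euler
      derivatives.\<close>
    have xxF: "(\<Sum>i\<in>UNIV. \<Sum>j\<in>UNIV. X i * X j * DF j i x) = Q x * S - u x * ((K^2 - K) * Q x)"
    proof -
      have "(\<Sum>i\<in>UNIV. \<Sum>j\<in>UNIV. X i * X j * DF j i x) =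
         (\<Sum>i\<in>UNIV. \<Sum>j\<in>UNIV. Q x * (X i * X j * UU j i x)) + (\<Sum>i\<in>UNIV. \<Sum>j\<in>UNIV. (X i * V i x) * (X j * U j x))
         - (\<Sum>i\<in>UNIV. \<Sum>j\<in>UNIV. u x * (X i * X j * VV j i x)) - (\<Sum>i\<in>UNIV. \<Sum>j\<in>UNIV. (X i * U i x) * (X j * V j x))"
        unfolding DF_def sum.distrib[symmetric] sum_subtractf[symmetric]
        by (intro sum.cong refl) (simp add: algebra_simps)
      also have "\<dots> = Q x * S + (K * Q x) * Eu x - u x * ((K^2 - K) * Q x) - Eu x * (K * Q x)"
        unfolding e1[symmetric] e2[symmetric] Eu[symmetric] S_def
        unfolding sum_product by (simp add: sum_distrib_left)
      finally show ?thesis by simp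
    qed
    \<comment> \<open>The product rule splits \<open>L i j\<close> into four terms. They sum to
      \<open>r^2\<close> times the divergence of \<open>F\<close>, to \<open>x . F\<close>, to
      \<open>- n\<close> times \<open>x . F\<close>, and to minus the sum of
      \<open>x_i x_j \<partial>_i F_j\<close>.\<close>
    have "(\<Sum>i\<in>UNIV. \<Sum>j\<in>UNIV. L i j x) = (\<Sum>i\<in>UNIV. \<Sum>j\<in>UNIV. (X i * X i) * DF j j x)
       + (\<Sum>i\<in>UNIV. \<Sum>j\<in>UNIV. if j = i then X j * F j x else 0)
       - (\<Sum>i\<in>(UNIV :: 'n set). \<Sum>j\<in>UNIV. X j * F j x) - (\<Sum>i\<in>UNIV. \<Sum>j\<in>UNIV. X i * X j * DF j i x)"
      unfolding L_def D_def X_def[symmetric] sum.distrib[symmetric] sum_subtractf[symmetric]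
      by (intro sum.cong refl) (simp add: algebra_simps)
    also have "\<dots> = of_real (r\<^sup>2) * (\<Sum>j\<in>UNIV. DF j j x) + (1 - n) * (\<Sum>j\<in>UNIV. X j * F j x)
       - (\<Sum>i\<in>UNIV. \<Sum>j\<in>UNIV. X i * X j * DF j i x)"
      unfolding r2[symmetric] sum_product by (simp add: n_def algebra_simps)
    \<comment> \<open>The constant \<open>K * (K + n - 2)\<close> is \<open>(n - 1) K\<close> from
      \<open>x . F\<close> plus \<open>K^2 - K\<close> from the second derivatives of
      \<open>Q\<close>.\<close>
    also have "\<dots> = Q x * (of_real (r\<^sup>2) * (\<Sum>i\<in>UNIV. UU i i x) + (2 - n) * Eu x - EEu x + K * (K + n - 2) * u x)"
      unfolding xF divF xxF EEu by (simp add: algebra_simps power2_eq_square)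
    finally show "(\<Sum>i\<in>UNIV. \<Sum>j\<in>UNIV. L i j (r *\<^sub>R \<theta>)) = (\<lambda>x. Q x * (of_real (r\<^sup>2) * (\<Sum>i\<in>UNIV. UU i i x) + (2 - of_nat CARD('n)) * Eu x - EEu x
      + of_nat k * (of_nat k + of_nat CARD('n) - 2) * u x)) (r *\<^sub>R \<theta>)"
      by (simp add: x_def n_def K_def)
  qed
  finally show ?thesis .
qed

section \<open>The radial equation of a spherical coefficient\<close>

text \<open>In the logarithmic radius, differentiation is the Euler field
  \<open>\<Sum> x_i \<partial>_i\<close> acting on \<open>g\<close>. The result has the same shape
  as the original integral, so the step can be repeated.\<close>

lemma has_vector_derivative_sph_int_exp:
  fixes g Q :: "real^'n::finite \<Rightarrow> complex"
  assumes g: "C1_on G g D" and Q: "continuous_on (sphere 0 1) Q"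
    and T: "open T" "v \<in> T" and G: "\<And>t \<theta>. t \<in> T \<Longrightarrow> norm \<theta> = 1 \<Longrightarrow> exp t *\<^sub>R \<theta> \<in> G"
  shows "((\<lambda>t. sph_int (\<lambda>\<theta>. g (exp t *\<^sub>R \<theta>) * Q \<theta>)) has_vector_derivative
    sph_int (\<lambda>\<theta>. (\<Sum>i\<in>UNIV. of_real ((exp v *\<^sub>R \<theta>) $ i) * D i (exp v *\<^sub>R \<theta>)) * Q \<theta>)) (at v)"
proof (rule has_vector_derivative_sph_int[OF T,
    where g' = "\<lambda>v \<theta>. (\<Sum>i\<in>UNIV. of_real ((exp v *\<^sub>R \<theta>) $ i) * D i (exp v *\<^sub>R \<theta>)) * Q \<theta>"])
  fix t assume t: "t \<in> T"
  show "continuous_on (sphere 0 1) (\<lambda>\<theta>. g (exp t *\<^sub>R \<theta>) * Q \<theta>)"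
    by (intro continuous_on_mult Q continuous_on_compose2[OF C1_onD(3)[OF g]])
      (auto intro!: continuous_intros G t)
  fix \<theta> :: "real^'n" assume \<theta>: "norm \<theta> = 1"
  have "((\<lambda>t. exp t *\<^sub>R \<theta>) has_vector_derivative exp t *\<^sub>R \<theta>) (at t)"
    by (auto intro!: derivative_eq_intros simp: has_vector_derivative_def[symmetric] has_real_derivative_iff_has_vector_derivative[symmetric])
  from C1_on_vector_derivative[OF g G[OF t \<theta>] this]
  show "((\<lambda>t. g (exp t *\<^sub>R \<theta>) * Q \<theta>) has_vector_derivative
      (\<Sum>i\<in>UNIV. of_real ((exp t *\<^sub>R \<theta>) $ i) * D i (exp t *\<^sub>R \<theta>)) * Q \<theta>) (at t)"
    by (rule has_vector_derivative_mult_left)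
next
  have "continuous_on (T \<times> sphere 0 1) (\<lambda>p. D i (exp (fst p) *\<^sub>R snd p))" for i
    by (rule continuous_on_compose2[OF C1_onD(2)[OF g]]) (auto intro!: continuous_intros G)
  moreover have "continuous_on (T \<times> sphere 0 1) (\<lambda>p. Q (snd p))"
    by (rule continuous_on_compose2[OF Q]) (auto intro!: continuous_intros)
  ultimately show "continuous_on (T \<times> sphere 0 1)
      (\<lambda>(t, \<theta>). (\<Sum>i\<in>UNIV. of_real ((exp t *\<^sub>R \<theta>) $ i) * D i (exp t *\<^sub>R \<theta>)) * Q \<theta>)"
    unfolding case_prod_unfold by (intro continuous_on_mult continuous_on_sum) (auto intro!: continuous_intros)
qed

lemma sph_int_lincomb:
  fixes a b c d :: "real^'n::finite \<Rightarrow> complex"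
  assumes "continuous_on (sphere 0 1) a" "continuous_on (sphere 0 1) b"
    "continuous_on (sphere 0 1) c" "continuous_on (sphere 0 1) d"
  shows "sph_int (\<lambda>\<theta>. s * (x * a \<theta> + y * b \<theta> - c \<theta> + z * d \<theta>))
    = s * (x * sph_int a + y * sph_int b - sph_int c + z * sph_int d)"
  using assms
  by (simp add: sph_int_cmult sph_int_add sph_int_diff continuous_on_add continuous_on_diff continuous_on_mult_left)

text \<open>Differentiating \<open>Q (t *\<^sub>R x) = t ^ k * Q x\<close> at \<open>t = 1\<close>
  gives Euler's identity. Its partial derivatives in \<open>x_j\<close>, multiplied by
  \<open>x_j\<close> and summed, give the second one.\<close>

lemma hom_harm_poly_euler:
  assumes P: "hom_harm_poly k P" and Q_def: "Q = (\<lambda>x. cnj (P x))"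
  shows "(\<Sum>i\<in>UNIV. of_real (x $ i) * pd i Q x) = of_nat k * Q x"
    and "(\<Sum>i\<in>UNIV. \<Sum>j\<in>UNIV. of_real (x $ i) * of_real (x $ j) * pd i (pd j Q) x) = (of_nat k ^ 2 - of_nat k) * Q x"
proof -
  note Q = hom_harm_poly_cnj(1)[OF P, folded Q_def]
  note C1 = polyfun_pd(2)[OF Q]
  show E1: "(\<Sum>i\<in>UNIV. of_real (x $ i) * pd i Q x) = of_nat k * Q x" for x
  proof -
    have "((\<lambda>t. t *\<^sub>R x) has_vector_derivative x) (at 1)"
      by (auto intro!: derivative_eq_intros)
    from C1_on_vector_derivative[OF C1 _ this]
    have "((\<lambda>t. Q (t *\<^sub>R x)) has_vector_derivative (\<Sum>i\<in>UNIV. of_real (x $ i) * pd i Q x)) (at 1)"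
      by simp
    moreover have "((\<lambda>t. of_real (t ^ k) * Q x) has_vector_derivative of_nat k * Q x) (at 1)"
    proof -
      have "((\<lambda>t. t ^ k *\<^sub>R Q x) has_vector_derivative
          (1 ^ k *\<^sub>R 0 + (real k * 1 ^ (k - Suc 0)) *\<^sub>R Q x)) (at 1)"
        by (intro has_vector_derivative_scaleR DERIV_pow has_vector_derivative_const)
      then show ?thesis by (simp add: scaleR_conv_of_real)
    qed
    moreover have "(\<lambda>t. Q (t *\<^sub>R x)) = (\<lambda>t. of_real (t ^ k) * Q x)"
      by (simp add: Q_def hom_harm_poly_cnj(2)[OF P])
    ultimately show ?thesis using vector_derivative_unique_at by metis
  qed
  have 1: "C1_on UNIV (\<lambda>x. \<Sum>i\<in>UNIV. of_real (x $ i) * pd i Q x)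
      (\<lambda>j x. \<Sum>i\<in>UNIV. of_real (x $ i) * pd j (pd i Q) x + (if j = i then 1 else 0) * pd i Q x)"
    by (intro C1_on_sum C1_on_mult C1_on_coord polyfun_pd Q) auto
  have 2: "C1_on UNIV (\<lambda>x. \<Sum>i\<in>UNIV. of_real (x $ i) * pd i Q x) (\<lambda>j x. of_nat k * pd j Q x + 0 * Q x)"
    unfolding E1 by (intro C1_on_mult C1_on_const C1)
  have "(\<Sum>i\<in>UNIV. of_real (x $ i) * pd j (pd i Q) x) + pd j Q x = of_nat k * pd j Q x" for j
    using C1_on_pd[OF 1, of x j] C1_on_pd[OF 2, of x j]
    by (simp add: sum.distrib if_distrib[of "\<lambda>x. x * _"] cong: if_cong)
  then have eq: "(\<Sum>i\<in>UNIV. of_real (x $ i) * pd j (pd i Q) x) = (of_nat k - 1) * pd j Q x" for j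
    by (simp add: algebra_simps)
  have "(\<Sum>j\<in>UNIV. \<Sum>i\<in>UNIV. of_real (x $ j) * of_real (x $ i) * pd j (pd i Q) x)
      = (\<Sum>j\<in>UNIV. of_real (x $ j) * ((of_nat k - 1) * pd j Q x))"
    unfolding eq[symmetric] sum_distrib_left by (simp add: mult.assoc)
  also have "\<dots> = (of_nat k - 1) * (\<Sum>j\<in>UNIV. of_real (x $ j) * pd j Q x)"
    unfolding sum_distrib_left by (simp add: algebra_simps)
  also have "\<dots> = (of_nat k ^ 2 - of_nat k) * Q x"
    unfolding E1 by (simp add: power2_eq_square algebra_simps)
  finally show "(\<Sum>i\<in>UNIV. \<Sum>j\<in>UNIV. of_real (x $ i) * of_real (x $ j) * pd i (pd j Q) x) = (of_nat k ^ 2 - of_nat k) * Q x" .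
qed

text \<open>\<open>H1\<close> and \<open>H2\<close> are the coefficients of the Euler field applied
  once and twice to \<open>h\<close>. The equation is Green's identity for \<open>h\<close> and the
  conjugate of \<open>Y\<close> on the sphere of radius \<open>exp v\<close>.\<close>

lemma fcoef_exp_ode:
  fixes h Y :: "real^'n::finite \<Rightarrow> complex"
  assumes Y: "hom_harm_poly k Y" and G: "open G" and h: "smooth_on G h"
    and T: "open T" and TG: "\<And>t \<theta>. t \<in> T \<Longrightarrow> norm \<theta> = 1 \<Longrightarrow> exp t *\<^sub>R \<theta> \<in> G"
  obtains H1 H2 where
    "\<And>v. v \<in> T \<Longrightarrow> ((\<lambda>v. fcoef h Y (exp v)) has_vector_derivative H1 v) (at v)"
    "\<And>v. v \<in> T \<Longrightarrow> (H1 has_vector_derivative H2 v) (at v)"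
    "\<And>v. v \<in> T \<Longrightarrow> H2 v + (of_nat CARD('n) - 2) * H1 v - of_nat k * (of_nat k + of_nat CARD('n) - 2) * fcoef h Y (exp v)
        = of_real (exp v ^ 2) * fcoef (lap h) Y (exp v)"
proof -
  define Q where "Q = (\<lambda>x. cnj (Y x))"
  have polyQ: "polyfun Q" unfolding Q_def by (rule hom_harm_poly_cnj(1)[OF Y])
  note C1Q = polyfun_pd(2)[OF polyQ]
  have Qc: "continuous_on S Q" for S
    using C1_onD(3)[OF C1Q] continuous_on_subset by blast
  have C1h: "C1_on G h (\<lambda>i. pd i h)" and C1h': "C1_on G (pd i h) (\<lambda>j. pd j (pd i h))" for i
    using smooth_on_C1_on[OF G] smooth_on_pd[OF G] h by blast+
  define E where "E x = (\<Sum>i\<in>UNIV. of_real (x $ i) * pd i h x)" for x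
  define DE where "DE j x = (\<Sum>i\<in>UNIV. of_real (x $ i) * pd j (pd i h) x + (if j = i then 1 else 0) * pd i h x)" for j x
  define EE where "EE x = (\<Sum>j\<in>UNIV. of_real (x $ j) * DE j x)" for x
  have C1E: "C1_on G E DE"
    unfolding E_def DE_def by (intro C1_on_sum C1_on_mult C1_on_coord C1h') auto
  define I where "I g v = sph_int (\<lambda>\<theta>. g (exp v *\<^sub>R \<theta>) * Q \<theta>)" for g v
  have fc: "fcoef g Y (exp v) = I g v" for g v by (simp add: fcoef_def I_def Q_def)
  have C1lap: "C1_on G (lap h) (\<lambda>i. pd i (lap h))"
    by (rule smooth_on_C1_on[OF G smooth_on_lap[OF G h]])
  have EEc: "continuous_on G EE"
    unfolding EE_def[abs_def] by (intro continuous_intros C1_onD(2)[OF C1E])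
  have "I EE v + (of_nat CARD('n) - 2) * I E v - of_nat k * (of_nat k + of_nat CARD('n) - 2) * I h v
     = of_real (exp v ^ 2) * I (lap h) v" if v: "v \<in> T" for v
  proof -
    define r where "r = exp v"
    define n where "n = complex_of_nat CARD('n)"
    define K where "K = complex_of_nat k"
    note rG = TG[OF v, folded r_def]
    have EE: "EE x = (\<Sum>i\<in>UNIV. of_real (x $ i) * pd i h x) + (\<Sum>i\<in>UNIV. \<Sum>j\<in>UNIV. of_real (x $ i) * of_real (x $ j) * pd i (pd j h) x)" for x
      unfolding EE_def DE_def
      by (simp add: sum.distrib distrib_left sum_distrib_left if_distrib[of "\<lambda>x. x * _"] mult.assoc cong: if_cong)
    have green: "sph_int (\<lambda>\<theta>. (\<lambda>x. Q x * (of_real (r\<^sup>2) * lap h x + (2 - n) * E x - EE x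
      + K * (K + n - 2) * h x)) (r *\<^sub>R \<theta>)) = 0"
    proof -
      note Q2 = polyfun_pd(2)[OF polyfun_pd(1)[OF polyQ]]
      note Q' = C1_on_subset[OF C1Q subset_UNIV]
        and Q'' = C1_on_subset[OF polyfun_pd(2)[OF polyfun_pd(1)[OF polyQ]] subset_UNIV]
      have "sph_int (\<lambda>\<theta>. (\<lambda>x. Q x * (of_real (r\<^sup>2) * (\<Sum>i\<in>UNIV. pd i (pd i h) x)
          + (2 - of_nat CARD('n)) * (\<Sum>i\<in>UNIV. of_real (x $ i) * pd i h x)
          - ((\<Sum>i\<in>UNIV. of_real (x $ i) * pd i h x)
            + (\<Sum>i\<in>UNIV. \<Sum>j\<in>UNIV. of_real (x $ i) * of_real (x $ j) * pd i (pd j h) x))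
          + of_nat k * (of_nat k + of_nat CARD('n) - 2) * h x)) (r *\<^sub>R \<theta>)) = 0"
        by (rule sph_int_green[OF C1h C1h' Q' Q''])
          (assumption | rule rG hom_harm_poly_cnj(3)[OF Y, folded Q_def, unfolded lap_def]
            hom_harm_poly_euler[OF Y Q_def])+
      then show ?thesis unfolding EE E_def lap_def n_def K_def by simp
    qed
    have cont: "continuous_on (sphere 0 1) (\<lambda>\<theta>. g (r *\<^sub>R \<theta>) * Q \<theta>)" if "continuous_on G g" for g
      by (intro continuous_on_mult Qc continuous_on_compose2[OF that]) (auto intro!: continuous_intros rG)
    \<comment> \<open>Homogeneity turns \<open>Q (r *\<^sub>R \<theta>)\<close> into
      \<open>r ^ k * Q \<theta>\<close>; the factor \<open>r ^ k\<close> is nonzero and drops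
      out.\<close>
    have "0 = sph_int (\<lambda>\<theta>. of_real (r ^ k) * (of_real (r\<^sup>2) * (lap h (r *\<^sub>R \<theta>) * Q \<theta>)
       + (2 - n) * (E (r *\<^sub>R \<theta>) * Q \<theta>) - EE (r *\<^sub>R \<theta>) * Q \<theta> + K * (K + n - 2) * (h (r *\<^sub>R \<theta>) * Q \<theta>)))"
      unfolding green[symmetric]
      by (rule sph_int_cong) (simp add: Q_def hom_harm_poly_cnj(2)[OF Y] algebra_simps)
    also have "\<dots> = of_real (r ^ k) * (of_real (r\<^sup>2) * I (lap h) v + (2 - n) * I E v - I EE v + K * (K + n - 2) * I h v)"
      unfolding I_def r_def[symmetric]
      by (intro sph_int_lincomb cont C1_onD(3)[OF C1E] EEc C1_onD(3)[OF C1lap] C1_onD(3)[OF C1h])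
    finally have "of_real (r\<^sup>2) * I (lap h) v + (2 - n) * I E v - I EE v + K * (K + n - 2) * I h v = 0"
      by (simp add: r_def)
    then show ?thesis unfolding r_def[symmetric] n_def[symmetric] K_def[symmetric] by (simp add: algebra_simps)
  qed
  moreover have "((\<lambda>v. I h v) has_vector_derivative I E v) (at v)" if "v \<in> T" for v
    unfolding I_def E_def by (rule has_vector_derivative_sph_int_exp[OF C1h Qc T that TG])
  moreover have "((\<lambda>v. I E v) has_vector_derivative I EE v) (at v)" if "v \<in> T" for v
    unfolding I_def EE_def by (rule has_vector_derivative_sph_int_exp[OF C1E Qc T that TG])
  ultimately show ?thesis using that[of "I E" "I EE"] unfolding fc by blast
qed

section \<open>Divided differences of the exponential\<close>

lemma prod_dist_int_interval:
  fixes a b x :: int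
  assumes "a \<le> x" "x \<le> b"
  shows "(\<Prod>\<mu>\<in>{a..b} - {x}. real_of_int \<bar>x - \<mu>\<bar>) = fact (nat (x - a)) * fact (nat (b - x))"
proof -
  have "(\<Prod>\<mu>\<in>{a..<x}. real_of_int \<bar>x - \<mu>\<bar>) = (\<Prod>i\<in>{1..nat (x - a)}. real i)"
    by (rule prod.reindex_bij_witness[of _ "\<lambda>i. x - int i" "\<lambda>\<mu>. nat (x - \<mu>)"]) (use assms in auto)
  moreover have "(\<Prod>\<mu>\<in>{x<..b}. real_of_int \<bar>x - \<mu>\<bar>) = (\<Prod>i\<in>{1..nat (b - x)}. real i)"
    by (rule prod.reindex_bij_witness[of _ "\<lambda>i. x + int i" "\<lambda>\<mu>. nat (\<mu> - x)"]) (use assms in auto)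
  moreover have "(\<Prod>\<mu>\<in>{a..<x} \<union> {x<..b}. real_of_int \<bar>x - \<mu>\<bar>)
      = (\<Prod>\<mu>\<in>{a..<x}. real_of_int \<bar>x - \<mu>\<bar>) * (\<Prod>\<mu>\<in>{x<..b}. real_of_int \<bar>x - \<mu>\<bar>)"
    by (rule prod.union_disjoint) auto
  moreover have "{a..b} - {x} = {a..<x} \<union> {x<..b}" using assms by auto
  ultimately show ?thesis by (simp only: fact_prod of_nat_prod of_nat_id)
qed

text \<open>Lagrange interpolation of the constant 1 at \<open>n + 1\<close> nodes: \<open>P\<close>
  has degree at most \<open>n\<close> and vanishes at every node, hence is 0. Its coefficient of
  order \<open>n\<close> is the sum in question, the constant 1 contributing nothing as
  \<open>n > 0\<close>.\<close>

lemma sum_inverse_prod_diff_eq_0: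
  fixes x :: "nat \<Rightarrow> 'a::field"
  assumes x: "inj_on x {..n}" and n: "n > 0"
  shows "(\<Sum>j\<le>n. 1 / (\<Prod>i\<in>{..n} - {j}. x j - x i)) = 0"
proof -
  define w where "w j = (\<Prod>i\<in>{..n} - {j}. x j - x i)" for j
  define p where "p j = (\<Prod>i\<in>{..n} - {j}. [:- x i, 1:])" for j
  define P where "P = (\<Sum>j\<le>n. smult (1 / w j) (p j)) - 1"
  have w0: "w j \<noteq> 0" if "j \<le> n" for j
    using x that by (auto simp: w_def inj_on_def)
  have deg: "degree (p j) = n" if "j \<le> n" for j
    using that by (simp add: p_def degree_prod_eq_sum_degree)
  have lead: "coeff (p j) n = 1" if "j \<le> n" for j
    using deg[OF that] lead_coeff_prod[of "\<lambda>i. [:- x i, 1:]" "{..n} - {j}"]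
    by (simp add: p_def)
  have pv: "poly (p j) (x i) = (if i = j then w j else 0)" if "i \<le> n" "j \<le> n" for i j
    using that by (auto simp: p_def w_def poly_prod)
  have "P = 0"
  proof (rule ccontr)
    assume P: "P \<noteq> 0"
    have "poly P (x i) = 0" if "i \<le> n" for i
      using that w0[OF that] by (simp add: P_def poly_sum pv if_distrib[of "\<lambda>y. _ * y"] cong: if_cong)
    then have "x ` {..n} \<subseteq> {z. poly P z = 0}" by auto
    then have "card (x ` {..n}) \<le> degree P"
      using card_mono[OF poly_roots_finite[OF P]] card_poly_roots_bound[OF P] by (meson le_trans)
    moreover have "degree P \<le> n"
      unfolding P_def by (intro degree_diff_le degree_sum_le) (auto intro: order_trans[OF degree_smult_le] simp: deg)
    ultimately show False by (simp add: card_image[OF x])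
  qed
  then have "coeff P n = 0" by simp
  moreover have "coeff (1 :: 'a poly) n = 0" using n by (intro coeff_eq_0) simp
  ultimately show ?thesis by (simp add: P_def coeff_sum lead w_def)
qed

text \<open>For \<open>L = lam d k\<close> and \<open>j \<le> n\<close> this is the value of
  \<open>q_n'\<close> at the exponent \<open>L j\<close>; the product form is the one that can be
  estimated.\<close>

definition node_denom :: "(nat \<Rightarrow> int) \<Rightarrow> nat \<Rightarrow> nat \<Rightarrow> complex" where
  "node_denom L n j = (\<Prod>i\<in>{..n} - {j}. of_int (L j) - of_int (L i))"

lemma poly_pderiv_qpoly:
  assumes "j \<le> n"
  shows "poly (pderiv (qpoly d k n)) (of_int (lam d k j)) = node_denom (lam d k) n j"
proof -
  let ?L = "lam d k" and ?f = "\<lambda>j. [:- of_int (lam d k j), 1:] :: complex poly"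
  have "poly (pderiv (qpoly d k n)) (of_int (?L j))
      = (\<Sum>a\<le>n. poly (prod ?f ({..n} - {a})) (of_int (?L j)))"
    by (simp add: qpoly_def pderiv_prod pderiv_pCons poly_sum atLeast0AtMost)
  also have "\<dots> = (\<Sum>a\<le>n. if a = j then node_denom ?L n j else 0)"
    using assms by (intro sum.cong refl) (auto simp: poly_prod node_denom_def)
  finally show ?thesis using assms by simp
qed

lemma node_denom_Suc:
  assumes "j \<le> n"
  shows "node_denom L (Suc n) j = node_denom L n j * (of_int (L j) - of_int (L (Suc n)))"
proof -
  have "{..Suc n} - {j} = insert (Suc n) ({..n} - {j})" using assms by auto
  then show ?thesis by (simp add: node_denom_def mult.commute)
qed

lemma node_denom_nonzero: "inj L \<Longrightarrow> node_denom L n j \<noteq> 0"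
  by (auto simp: node_denom_def inj_def)

text \<open>The fundamental function: the divided difference of \<open>e\<^bsup>\<lambda>x\<^esup>\<close> in \<open>\<lambda>\<close> at the nodes \<open>L 0, \<dots>, L n\<close>.\<close>
definition exp_divdiff :: "(nat \<Rightarrow> int) \<Rightarrow> nat \<Rightarrow> real \<Rightarrow> complex" where
  "exp_divdiff L n x = (\<Sum>j\<le>n. of_real (exp (of_int (L j) * x)) / node_denom L n j)"

text \<open>At 0 these are the divided differences of the constant 1. They make the Taylor sum
  collapse to its first term at \<open>t = v\<close>.\<close>

lemma exp_divdiff_0:
  assumes "inj L"
  shows "exp_divdiff L n 0 = (if n = 0 then 1 else 0)"
proof (cases "n = 0")
  case False
  have "inj_on (\<lambda>j. complex_of_int (L j)) {..n}" using assms by (auto simp: inj_on_def inj_def)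
  from sum_inverse_prod_diff_eq_0[OF this] False show ?thesis
    by (simp add: exp_divdiff_def node_denom_def)
qed (simp add: exp_divdiff_def node_denom_def)

text \<open>Thus \<open>d/dx - L n\<close> lowers the index: in the term \<open>j\<close> the factor
  \<open>L j - L n\<close> cancels the last factor of \<open>node_denom L n j\<close>, and the term
  \<open>j = n\<close> disappears.\<close>

lemma has_vector_derivative_exp_divdiff:
  assumes L: "inj L"
  shows "(exp_divdiff L n has_vector_derivative
    of_int (L n) * exp_divdiff L n x + (case n of 0 \<Rightarrow> 0 | Suc m \<Rightarrow> exp_divdiff L m x)) (at x)"
proof -
  have "((\<lambda>x. of_real (exp (of_int (L j) * x)) / node_denom L n j) has_vector_derivative
      of_int (L j) * of_real (exp (of_int (L j) * x)) / node_denom L n j) (at x)" for j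
  proof -
    have "((\<lambda>x. exp (of_int (L j) * x)) has_real_derivative of_int (L j) * exp (of_int (L j) * x)) (at x)"
      by (auto intro!: derivative_eq_intros)
    from has_vector_derivative_scaleR[OF this has_vector_derivative_const, of "1 / node_denom L n j"]
    show ?thesis by (simp add: scaleR_conv_of_real)
  qed
  then have "(exp_divdiff L n has_vector_derivative
      (\<Sum>j\<le>n. of_int (L j) * of_real (exp (of_int (L j) * x)) / node_denom L n j)) (at x)"
    unfolding exp_divdiff_def[abs_def] by (intro has_vector_derivative_sum) auto
  moreover have "(\<Sum>j\<le>n. of_int (L j) * of_real (exp (of_int (L j) * x)) / node_denom L n j)
     = of_int (L n) * exp_divdiff L n x + (case n of 0 \<Rightarrow> 0 | Suc m \<Rightarrow> exp_divdiff L m x)"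
  proof (cases n)
    case 0
    then show ?thesis by (simp add: exp_divdiff_def)
  next
    case (Suc m)
    have "of_int (L j) * E / node_denom L n j = of_int (L n) * (E / node_denom L n j) + E / node_denom L m j"
      if "j \<le> m" for j and E :: complex
    proof -
      define c where "c = complex_of_int (L j) - of_int (L n)"
      have "node_denom L n j = node_denom L m j * c"
        using node_denom_Suc[OF that] Suc by (simp add: c_def)
      moreover have "node_denom L m j \<noteq> 0" by (rule node_denom_nonzero[OF L])
      moreover have "c \<noteq> 0" using injD[OF L, of j n] that Suc by (auto simp: c_def)
      moreover have "complex_of_int (L j) = of_int (L n) + c" by (simp add: c_def)
      ultimately show ?thesis by (simp add: field_simps)
    qed
    then show ?thesis unfolding Suc
      by (simp add: exp_divdiff_def Suc sum_distrib_left sum.distrib distrib_left)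
  qed
  ultimately show ?thesis by simp
qed

text \<open>For odd \<open>d\<close> the even and the odd indices give exponents of opposite parity,
  and each of the two families is strictly increasing.\<close>

lemma lam_inj: "odd d \<Longrightarrow> inj (lam d k)"
  unfolding inj_def lam_def by (auto split: if_splits elim!: evenE oddE) presburger+

lemma lam_bounds:
  assumes "d > 1" "j \<le> n"
  shows "2 - int d - int k \<le> lam d k j" "lam d k j \<le> int k + int n"
  using assms by (auto simp: lam_def)

text \<open>The nodes \<open>\<lambda>\<^sub>0, \<dots>, \<lambda>\<^sub>n\<close> are all but \<open>M = 2k + d - 2\<close> of the integers of an interval of length
  \<open>n + M\<close>, so the reciprocal denominators are binomial coefficients up to a polynomial factor.\<close>
lemma sum_power_over_node_denom_le:
  fixes \<rho> :: real and d k :: nat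
  assumes d: "odd d" "d > 1" and \<rho>: "\<rho> > 0"
  defines "M \<equiv> 2 * k + d - 2"
  shows "(\<Sum>j\<le>n. \<rho> powi (lam d k j) / norm (node_denom (lam d k) n j))
    \<le> real (n + M) ^ M * \<rho> powi (2 - int d - int k) * (1 + \<rho>) ^ (n + M) / fact n"
proof -
  let ?L = "lam d k"
  define a b where "a = 2 - int d - int k" and "b = int k + int n"
  have ba: "b - a = int (n + M)" using d by (simp add: a_def b_def M_def)
  have L: "?L j \<in> {a..b}" if "j \<le> n" for j using lam_bounds[OF d(2) that] by (simp add: a_def b_def)
  have inj: "inj ?L" by (rule lam_inj[OF d(1)])
  \<comment> \<open>The position of an exponent in the interval, which becomes the lower index of a
    binomial coefficient.\<close>
  define t where "t j = nat (?L j - a)" for j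
  have tn: "t j \<le> n + M" if "j \<le> n" for j using L[OF that] ba by (auto simp: t_def nat_le_iff)
  have term_le: "\<rho> powi (?L j) / norm (node_denom ?L n j)
      \<le> real (n + M) ^ M * \<rho> powi a / fact n * (real ((n + M) choose t j) * \<rho> ^ t j)" if j: "j \<le> n" for j
  proof -
    let ?x = "?L j"
    define Z where "Z = ?L ` ({..n} - {j})"
    \<comment> \<open>The integers of the interval that are not nodes: \<open>n + M + 1\<close>
      integers against \<open>n + 1\<close> nodes leave \<open>M\<close>. Each is within
      \<open>n + M\<close> of \<open>?x\<close>, whence the factor
      \<open>(n + M) ^ M\<close>.\<close>
    define U where "U = {a..b} - {?x} - Z"
    have ZI: "Z \<subseteq> {a..b} - {?x}" using L inj by (auto simp: Z_def inj_def)
    have cZ: "card Z = n" using j inj by (simp add: Z_def card_image inj_on_def inj_def)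
    have cU: "card U = M"
      using L[OF j] ba cZ ZI by (simp add: U_def card_Diff_subset finite_subset[OF ZI])
    have "norm (node_denom ?L n j) = (\<Prod>i\<in>{..n} - {j}. real_of_int \<bar>?x - ?L i\<bar>)"
      by (simp add: node_denom_def prod_norm[symmetric] norm_of_int flip: of_int_diff)
    also have "\<dots> = (\<Prod>\<mu>\<in>Z. real_of_int \<bar>?x - \<mu>\<bar>)"
      unfolding Z_def using inj by (subst prod.reindex) (auto simp: inj_on_def inj_def)
    finally have nd: "norm (node_denom ?L n j) = (\<Prod>\<mu>\<in>Z. real_of_int \<bar>?x - \<mu>\<bar>)" .
    have "(\<Prod>\<mu>\<in>U. real_of_int \<bar>?x - \<mu>\<bar>) \<le> (\<Prod>\<mu>\<in>U. real (n + M))"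
    proof (rule prod_mono)
      fix \<mu> assume "\<mu> \<in> U"
      then have "\<bar>?x - \<mu>\<bar> \<le> int (n + M)" using L[OF j] ba by (auto simp: U_def)
      then show "0 \<le> real_of_int \<bar>?x - \<mu>\<bar> \<and> real_of_int \<bar>?x - \<mu>\<bar> \<le> real (n + M)"
        by (metis abs_ge_zero of_int_0_le_iff of_int_le_iff of_int_of_nat_eq)
    qed
    then have PU: "(\<Prod>\<mu>\<in>U. real_of_int \<bar>?x - \<mu>\<bar>) \<le> real (n + M) ^ M" by (simp add: cU)
    have "(\<Prod>\<mu>\<in>{a..b} - {?x}. real_of_int \<bar>?x - \<mu>\<bar>) = (\<Prod>\<mu>\<in>U. real_of_int \<bar>?x - \<mu>\<bar>) * norm (node_denom ?L n j)"
      unfolding nd U_def by (rule prod.subset_diff) (use ZI in auto)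
    moreover have "nat (b - ?x) = n + M - t j" 
      using L[OF j] ba unfolding t_def by (simp only: atLeastAtMost_iff) arith
    ultimately have "fact (t j) * fact (n + M - t j) = (\<Prod>\<mu>\<in>U. real_of_int \<bar>?x - \<mu>\<bar>) * norm (node_denom ?L n j)"
      using prod_dist_int_interval[of a ?x b] L[OF j] by (simp add: t_def)
    also have "\<dots> \<le> real (n + M) ^ M * norm (node_denom ?L n j)"
      by (rule mult_right_mono[OF PU]) simp
    finally have F: "fact (t j) * fact (n + M - t j) \<le> real (n + M) ^ M * norm (node_denom ?L n j)" .
    have "fact (n + M) = fact (t j) * fact (n + M - t j) * real ((n + M) choose t j)"
      using binomial_fact_lemma[OF tn[OF j]] by (metis of_nat_fact of_nat_mult)
    also have "\<dots> \<le> real (n + M) ^ M * norm (node_denom ?L n j) * real ((n + M) choose t j)"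
      by (rule mult_right_mono[OF F]) simp
    \<comment> \<open>Lowering \<open>fact (n + M)\<close> to \<open>fact n\<close> gives away only
      a polynomial factor.\<close>
    finally have "fact n \<le> real (n + M) ^ M * norm (node_denom ?L n j) * real ((n + M) choose t j)"
      using fact_mono[of n "n + M", where 'a=real] by linarith
    then have "1 / norm (node_denom ?L n j) \<le> real (n + M) ^ M / fact n * real ((n + M) choose t j)"
      using node_denom_nonzero[OF inj, of n j] by (simp add: field_simps)
    then have "\<rho> powi ?x * (1 / norm (node_denom ?L n j)) \<le> \<rho> powi ?x * (real (n + M) ^ M / fact n * real ((n + M) choose t j))"
      using \<rho> by (intro mult_left_mono) (auto simp: zero_le_power_int)
    moreover have "\<rho> powi ?x = \<rho> powi a * \<rho> ^ t j"
      using L[OF j] \<rho> power_int_add[of \<rho> a "?L j - a"] by (simp add: t_def power_int_def)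
    ultimately show ?thesis by (simp add: mult_ac)
  qed
  \<comment> \<open>Distinct nodes occupy distinct positions, so their terms form a part of the
    binomial expansion of \<open>(1 + \<rho>) ^ (n + M)\<close>.\<close>
  have tinj: "inj_on t {..n}"
  proof (rule inj_onI)
    fix i j assume ij: "i \<in> {..n}" "j \<in> {..n}" "t i = t j"
    then have "?L i = ?L j" using L[of i] L[of j] by (simp add: t_def eq_nat_nat_iff)
    then show "i = j" using inj by (simp add: inj_def)
  qed
  have "(\<Sum>j\<le>n. \<rho> powi (?L j) / norm (node_denom ?L n j))
      \<le> (\<Sum>j\<le>n. real (n + M) ^ M * \<rho> powi a / fact n * (real ((n + M) choose t j) * \<rho> ^ t j))"
    by (intro sum_mono term_le) simp
  also have "\<dots> = real (n + M) ^ M * \<rho> powi a / fact n * (\<Sum>j\<in>t ` {..n}. real ((n + M) choose j) * \<rho> ^ j)"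
    by (simp add: sum.reindex[OF tinj] sum_distrib_left o_def)
  also have "\<dots> \<le> real (n + M) ^ M * \<rho> powi a / fact n * (\<Sum>j\<le>n + M. real ((n + M) choose j) * \<rho> ^ j)"
    by (intro mult_left_mono sum_mono2) (use \<rho> tn in \<open>auto simp: zero_le_power_int\<close>)
  also have "(\<Sum>j\<le>n + M. real ((n + M) choose j) * \<rho> ^ j) = (1 + \<rho>) ^ (n + M)"
    using binomial_ring[of \<rho> 1 "n + M"] by (simp add: add.commute)
  finally show ?thesis by (simp add: a_def mult_ac)
qed

lemma norm_exp_divdiff_le:
  fixes d k :: nat
  assumes d: "odd d" "d > 1"
  defines "M \<equiv> 2 * k + d - 2"
  shows "norm (exp_divdiff (lam d k) n x)
    \<le> real (n + M) ^ M * exp x powi (2 - int d - int k) * (1 + exp x) ^ (n + M) / fact n"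
proof -
  have "norm (exp_divdiff (lam d k) n x) \<le> (\<Sum>j\<le>n. norm (of_real (exp (of_int (lam d k j) * x)) / node_denom (lam d k) n j))"
    unfolding exp_divdiff_def by (rule norm_sum)
  also have "\<dots> = (\<Sum>j\<le>n. exp x powi (lam d k j) / norm (node_denom (lam d k) n j))"
    by (simp add: norm_divide exp_power_int)
  also have "\<dots> \<le> real (n + M) ^ M * exp x powi (2 - int d - int k) * (1 + exp x) ^ (n + M) / fact n"
    unfolding M_def by (rule sum_power_over_node_denom_le[OF d]) simp
  finally show ?thesis .
qed

section \<open>The operators D on solutions of the radial equations\<close>

text \<open>A Landau-type inequality in which \<open>H2 + c * H1\<close> is controlled, as in the
  radial equation. This is the derivative of \<open>W\<close>, so \<open>H1\<close> stays within
  \<open>B\<close> of the constant \<open>W v\<close>; the increment of \<open>H\<close> over a step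
  of length \<open>\<delta>\<close> then bounds \<open>W v\<close>.\<close>

lemma derivative_bound_interpolation:
  fixes H H1 H2 :: "real \<Rightarrow> complex"
  assumes ab: "\<alpha> < \<beta>"
    and H: "\<And>v. v \<in> {\<alpha>..\<beta>} \<Longrightarrow> (H has_vector_derivative H1 v) (at v)"
    and H1: "\<And>v. v \<in> {\<alpha>..\<beta>} \<Longrightarrow> (H1 has_vector_derivative H2 v) (at v)"
    and A: "\<And>v. v \<in> {\<alpha>..\<beta>} \<Longrightarrow> norm (H v) \<le> A"
    and M: "\<And>v. v \<in> {\<alpha>..\<beta>} \<Longrightarrow> norm (H2 v + c * H1 v) \<le> M"
    and v: "v \<in> {\<alpha>..\<beta>}"
  shows "norm (H1 v) \<le> (4 / (\<beta> - \<alpha>) + 2 * norm c) * A + (\<beta> - \<alpha>) * M"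
proof -
  define W where "W v = H1 v + c * H v" for v
  define B where "B = M * (\<beta> - \<alpha>) + norm c * A"
  have W: "(W has_vector_derivative H2 \<xi> + c * H1 \<xi>) (at \<xi>)" if "\<xi> \<in> {\<alpha>..\<beta>}" for \<xi>
    unfolding W_def[abs_def] by (intro has_vector_derivative_add has_vector_derivative_mult_right H H1 that)
  have M0: "M \<ge> 0" using M[OF v] norm_ge_zero order_trans by blast
  have "norm (H1 \<xi> - W v) \<le> B" if \<xi>: "\<xi> \<in> {\<alpha>..\<beta>}" for \<xi>
  proof -
    have "norm (W \<xi> - W v - (\<xi> - v) *\<^sub>R 0) \<le> M * \<bar>\<xi> - v\<bar>"
      by (rule vector_derivative_linear_bound[of "{\<alpha>..\<beta>}", OF _ v \<xi> W]) (use M in auto)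
    also have "\<dots> \<le> M * (\<beta> - \<alpha>)" using \<xi> v M0 by (intro mult_left_mono) auto
    finally have 1: "norm (W \<xi> - W v) \<le> M * (\<beta> - \<alpha>)" by simp
    have 2: "norm (c * H \<xi>) \<le> norm c * A" using A[OF \<xi>] by (simp add: norm_mult mult_left_mono)
    have eq: "H1 \<xi> - W v = (W \<xi> - W v) - c * H \<xi>" by (simp add: W_def)
    show ?thesis unfolding eq B_def using norm_triangle_ineq4[of "W \<xi> - W v" "c * H \<xi>"] 1 2 by linarith
  qed
  note B = this
  \<comment> \<open>Half the interval, so that \<open>v + \<delta>\<close> or
    \<open>v - \<delta>\<close> stays inside. The term \<open>2 * A / \<delta>\<close> becomes
    \<open>4 / (\<beta> - \<alpha>) * A\<close>.\<close>
  define \<delta> where "\<delta> = (\<beta> - \<alpha>) / 2"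
  have \<delta>: "\<delta> > 0" using ab by (simp add: \<delta>_def)
  define w where "w = (if v \<le> (\<alpha> + \<beta>) / 2 then v + \<delta> else v - \<delta>)"
  have w: "w \<in> {\<alpha>..\<beta>}" "\<bar>w - v\<bar> = \<delta>" using v \<delta> by (auto simp: w_def \<delta>_def field_simps)
  have "norm (H w - H v - (w - v) *\<^sub>R W v) \<le> B * \<bar>w - v\<bar>"
    by (rule vector_derivative_linear_bound[of "{\<alpha>..\<beta>}", OF _ v w(1) H B]) auto
  then have "norm ((w - v) *\<^sub>R W v) \<le> B * \<delta> + norm (H w - H v)"
    using norm_triangle_sub[of "(w - v) *\<^sub>R W v" "H w - H v"] w by (simp add: norm_minus_commute)
  also have "norm (H w - H v) \<le> 2 * A"
    using norm_triangle_ineq4[of "H w" "H v"] A[OF w(1)] A[OF v] by simp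
  finally have "\<delta> * norm (W v) \<le> B * \<delta> + 2 * A" using w by simp
  then have "norm (W v) \<le> B + 2 * A / \<delta>" using \<delta> by (simp add: field_simps)
  moreover have "norm (H1 v) \<le> norm (W v) + norm c * A"
  proof -
    have "norm (H1 v) = norm (W v - c * H v)" by (simp add: W_def)
    also have "\<dots> \<le> norm (W v) + norm (c * H v)" by (rule norm_triangle_ineq4)
    also have "norm (c * H v) \<le> norm c * A" using A[OF v] by (simp add: norm_mult mult_left_mono)
    finally show ?thesis by simp
  qed
  ultimately show ?thesis by (simp add: B_def \<delta>_def algebra_simps)
qed

lemma has_vector_derivative_exp_pow_mult:
  fixes X :: "real \<Rightarrow> complex"
  assumes "(X has_vector_derivative X') (at v)"
  shows "((\<lambda>v. of_real (exp v ^ m) * X v) has_vector_derivative of_real (exp v ^ m) * (of_nat m * X v + X')) (at v)"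
proof -
  have "((\<lambda>v. exp v ^ m) has_real_derivative real m * exp v ^ m) (at v)"
    unfolding exp_of_nat_mult[symmetric] by (auto intro!: derivative_eq_intros)
  from has_vector_derivative_scaleR[OF this assms] show ?thesis
    by (simp add: scaleR_conv_of_real algebra_simps)
qed

text \<open>\<open>H p\<close> stands for the spherical coefficient of \<open>(lap ^^ p) f\<close>,
  as a function of the logarithmic radius. The chain of equations in \<open>p\<close> is all that is
  kept of the sphere; the estimates in the locale are one-dimensional.\<close>

locale radial_ode =
  fixes d k :: nat and J :: "real set" and H H1 H2 :: "nat \<Rightarrow> real \<Rightarrow> complex"
  assumes J: "open J"
    and H: "\<And>p v. v \<in> J \<Longrightarrow> (H p has_vector_derivative H1 p v) (at v)"
    and H1: "\<And>p v. v \<in> J \<Longrightarrow> (H1 p has_vector_derivative H2 p v) (at v)"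
    and ode: "\<And>p v. v \<in> J \<Longrightarrow> H2 p v + (of_nat d - 2) * H1 p v - of_nat k * (of_nat k + of_nat d - 2) * H p v
        = of_real (exp v ^ 2) * H (Suc p) v"
begin

abbreviation "L \<equiv> lam d k"

text \<open>Passing \<open>exp v ^ m\<close> through the operator shifts the exponent by
  \<open>m\<close>. With \<open>m = 2 * p\<close> the exponents of index \<open>2 * p\<close> and
  \<open>2 * p + 1\<close> become \<open>k\<close> and \<open>- k - d + 2\<close>, so every two
  steps repeat the two factors of the radial equation.\<close>

lemma Dop_step:
  assumes eq: "\<And>v. v \<in> J \<Longrightarrow> Dop L n (H 0) v = of_real (exp v ^ m) * X v"
    and v: "v \<in> J" and X: "(X has_vector_derivative X') (at v)"
  shows "(Dop L n (H 0) has_vector_derivative of_real (exp v ^ m) * (of_nat m * X v + X')) (at v)"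
    and "Dop L (Suc n) (H 0) v = of_real (exp v ^ m) * ((of_nat m - of_int (L n)) * X v + X')"
proof -
  show *: "(Dop L n (H 0) has_vector_derivative of_real (exp v ^ m) * (of_nat m * X v + X')) (at v)"
    by (rule has_vector_derivative_transform_within_open[OF has_vector_derivative_exp_pow_mult[OF X] J v])
      (simp add: eq)
  show "Dop L (Suc n) (H 0) v = of_real (exp v ^ m) * ((of_nat m - of_int (L n)) * X v + X')"
    by (simp add: vector_derivative_at[OF *] eq[OF v] algebra_simps)
qed

lemma Dop_odd_of_even:
  assumes "\<And>v. v \<in> J \<Longrightarrow> Dop L (2 * p) (H 0) v = of_real (exp v ^ (2 * p)) * H p v" and v: "v \<in> J"
  shows "Dop L (Suc (2 * p)) (H 0) v = of_real (exp v ^ (2 * p)) * (H1 p v - of_nat k * H p v)"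
  using Dop_step(2)[OF assms H[OF v]] by (simp add: lam_def algebra_simps del: Dop.simps)

lemma Dop_even: "v \<in> J \<Longrightarrow> Dop L (2 * p) (H 0) v = of_real (exp v ^ (2 * p)) * H p v"
proof (induction p arbitrary: v)
  case (Suc p)
  have X: "((\<lambda>v. H1 p v - of_nat k * H p v) has_vector_derivative H2 p v - of_nat k * H1 p v) (at v)"
    by (intro has_vector_derivative_diff has_vector_derivative_mult_right H H1 Suc.prems)
  have "L (Suc (2 * p)) = - int k - int d + 2 + 2 * int p" by (simp add: lam_def)
  then have "Dop L (Suc (Suc (2 * p))) (H 0) v = of_real (exp v ^ (2 * p)) *
      ((of_nat k + of_nat d - 2) * (H1 p v - of_nat k * H p v) + (H2 p v - of_nat k * H1 p v))"
    using Dop_step(2)[OF Dop_odd_of_even[OF Suc.IH] Suc.prems X] by (simp del: Dop.simps)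
  also have "(of_nat k + of_nat d - 2) * (H1 p v - of_nat k * H p v) + (H2 p v - of_nat k * H1 p v)
      = H2 p v + (of_nat d - 2) * H1 p v - of_nat k * (of_nat k + of_nat d - 2) * H p v"
    by (simp add: algebra_simps)
  also have "\<dots> = of_real (exp v ^ 2) * H (Suc p) v" by (rule ode[OF Suc.prems])
  finally show ?case by (simp add: power2_eq_square mult.assoc del: Dop.simps)
qed simp

lemma Dop_odd:
  "v \<in> J \<Longrightarrow> Dop L (Suc (2 * p)) (H 0) v = of_real (exp v ^ (2 * p)) * (H1 p v - of_nat k * H p v)"
  by (rule Dop_odd_of_even[OF Dop_even])

text \<open>The content is differentiability, read off from the explicit form in either parity; the
  value is the recursion of \<open>Dop\<close> solved for the derivative.\<close>

lemma has_vector_derivative_Dop: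
  assumes v: "v \<in> J"
  shows "(Dop L n (H 0) has_vector_derivative Dop L (Suc n) (H 0) v + of_int (L n) * Dop L n (H 0) v) (at v)"
proof -
  have "\<exists>D. (Dop L n (H 0) has_vector_derivative D) (at v)"
  proof (cases "even n")
    case True
    then obtain p where n: "n = 2 * p" by blast
    show ?thesis unfolding n using Dop_step(1)[OF Dop_even v H[OF v]] by blast
  next
    case False
    then obtain p where n: "n = Suc (2 * p)" using oddE by fastforce
    have X: "((\<lambda>v. H1 p v - of_nat k * H p v) has_vector_derivative H2 p v - of_nat k * H1 p v) (at v)"
      by (intro has_vector_derivative_diff has_vector_derivative_mult_right H H1 v)
    show ?thesis unfolding n using Dop_step(1)[OF Dop_odd v X] by blast
  qed
  then show ?thesis using vector_derivative_at by fastforce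
qed

text \<open>For odd \<open>n = 2 * p + 1\<close> the interpolation draws on
  \<open>H (Suc p)\<close>, whose bound contains \<open>fact (2 * p + 2) = (n + 1) * fact n\<close>;
  this is the origin of the factor \<open>n + 1\<close>.\<close>

lemma Dop_bound:
  assumes ab: "\<alpha> < \<beta>" "{\<alpha>..\<beta>} \<subseteq> J" and s: "s > 0" and C: "C > 0"
    and H_le: "\<And>p v. v \<in> {\<alpha>..\<beta>} \<Longrightarrow> norm (H p v) \<le> C * fact (2 * p) * s ^ (2 * p)"
  shows "\<exists>C'>0. \<forall>n. \<forall>v\<in>{\<alpha>..\<beta>}. norm (Dop L n (H 0) v) \<le> C' * (real n + 1) * fact n * (s * exp v) ^ n"
proof -
  define c where "c = complex_of_nat d - 2"
  define \<kappa> where "\<kappa> = complex_of_nat k * (of_nat k + of_nat d - 2)"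
  define a1 where "a1 = 4 / (\<beta> - \<alpha>) + 2 * norm c"
  define a2 where "a2 = \<beta> - \<alpha>"
  define C1 where "C1 = C * (a1 + a2 * (exp \<beta> ^ 2 * s ^ 2 + norm \<kappa>) + real k)"
  have a: "a1 \<ge> 0" "a2 \<ge> 0" using ab by (simp_all add: a1_def a2_def)
  have C1: "C1 \<ge> 0" using C a by (simp add: C1_def)
  have odd_le: "norm (H1 p v - of_nat k * H p v) \<le> C1 * (fact (2 * Suc p) * s ^ (2 * p))" if v: "v \<in> {\<alpha>..\<beta>}" for p v
  proof -
    \<comment> \<open>A common majorant: it dominates \<open>H p\<close> and, up to the factor
      \<open>s ^ 2\<close>, also \<open>H (Suc p)\<close>.\<close>
    define A where "A = C * fact (2 * Suc p) * s ^ (2 * p)"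
    have A0: "A \<ge> 0" using C s by (simp add: A_def)
    have A: "norm (H p v) \<le> A" if "v \<in> {\<alpha>..\<beta>}" for v
    proof -
      have "C * fact (2 * p) * s ^ (2 * p) \<le> A"
        unfolding A_def by (intro mult_left_mono mult_right_mono fact_mono) (use C s in auto)
      then show ?thesis using H_le[OF that, of p] by linarith
    qed
    have A': "norm (H (Suc p) v) \<le> s ^ 2 * A" if "v \<in> {\<alpha>..\<beta>}" for v
      using H_le[OF that, of "Suc p"] by (simp add: A_def power_add power2_eq_square mult_ac)
    have M: "norm (H2 p v + c * H1 p v) \<le> (exp \<beta> ^ 2 * s ^ 2 + norm \<kappa>) * A" if "v \<in> {\<alpha>..\<beta>}" for v
    proof -
      have "H2 p v + c * H1 p v = of_real (exp v ^ 2) * H (Suc p) v + \<kappa> * H p v"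
        using ode[of v p] ab that by (auto simp: c_def \<kappa>_def algebra_simps)
      also have "norm \<dots> \<le> norm (of_real (exp v ^ 2) * H (Suc p) v) + norm (\<kappa> * H p v)"
        by (rule norm_triangle_ineq)
      also have "norm (of_real (exp v ^ 2) * H (Suc p) v) = exp v ^ 2 * norm (H (Suc p) v)"
        by (simp add: norm_mult norm_power)
      also have "\<dots> \<le> exp \<beta> ^ 2 * (s ^ 2 * A)"
        by (intro mult_mono power_mono A' that) (use that in auto)
      also have "norm (\<kappa> * H p v) \<le> norm \<kappa> * A" using A[OF that] by (simp add: norm_mult mult_left_mono)
      finally show ?thesis by (simp add: algebra_simps)
    qed
    have "norm (H1 p v) \<le> a1 * A + a2 * ((exp \<beta> ^ 2 * s ^ 2 + norm \<kappa>) * A)"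
      unfolding a1_def a2_def
      by (rule derivative_bound_interpolation[OF ab(1) H H1 A M v]) (use ab in auto)
    moreover have "norm (of_nat k * H p v) \<le> real k * A" using A[OF v] by (simp add: norm_mult mult_left_mono)
    ultimately have "norm (H1 p v - of_nat k * H p v) \<le> a1 * A + a2 * ((exp \<beta> ^ 2 * s ^ 2 + norm \<kappa>) * A) + real k * A"
      using norm_triangle_ineq4[of "H1 p v" "of_nat k * H p v"] by linarith
    then show ?thesis by (simp add: C1_def A_def algebra_simps)
  qed
  \<comment> \<open>In odd order only \<open>2 * p\<close> powers of \<open>s * exp v\<close> are at
    hand where \<open>2 * p + 1\<close> are wanted; the missing one is bounded below by its value at
    \<open>\<alpha>\<close>.\<close>
  define C' where "C' = C + C1 / (s * exp \<alpha>)"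
  have C'0: "C' > 0" using C C1 s by (simp add: C'_def add_pos_nonneg)
  have "norm (Dop L n (H 0) v) \<le> C' * (real n + 1) * fact n * (s * exp v) ^ n" if v: "v \<in> {\<alpha>..\<beta>}" for n v
  proof (cases "even n")
    case True
    then obtain p where n: "n = 2 * p" by blast
    have vJ: "v \<in> J" using v ab by auto
    have "norm (Dop L n (H 0) v) = exp v ^ n * norm (H p v)"
      unfolding n Dop_even[OF vJ] by (simp add: norm_mult norm_power)
    also have "\<dots> \<le> exp v ^ n * (C * fact n * s ^ n)"
      using H_le[OF v, of p] by (intro mult_left_mono) (auto simp: n)
    also have "\<dots> = C * (fact n * (s * exp v) ^ n)" by (simp add: power_mult_distrib)
    also have "\<dots> \<le> (C' * (real n + 1)) * (fact n * (s * exp v) ^ n)"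
    proof (rule mult_right_mono)
      have "C * 1 \<le> C' * (real n + 1)" using C C1 s by (intro mult_mono) (auto simp: C'_def)
      then show "C \<le> C' * (real n + 1)" by simp
    qed (use s in auto)
    finally show ?thesis by (simp add: mult.assoc)
  next
    case False
    then obtain p where n: "n = Suc (2 * p)" using oddE by fastforce
    have vJ: "v \<in> J" using v ab by auto
    have "norm (Dop L n (H 0) v) = exp v ^ (2 * p) * norm (H1 p v - of_nat k * H p v)"
      unfolding n Dop_odd[OF vJ] by (simp add: norm_mult norm_power)
    also have "\<dots> \<le> exp v ^ (2 * p) * (C1 * (fact (2 * Suc p) * s ^ (2 * p)))"
      using odd_le[OF v, of p] by (intro mult_left_mono) auto
    also have "\<dots> = C1 / (s * exp v) * (real n + 1) * (fact n * (s * exp v) ^ n)"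
      using s by (simp add: n power_mult_distrib field_simps)
    also have "\<dots> \<le> (C' * (real n + 1)) * (fact n * (s * exp v) ^ n)"
    proof (intro mult_right_mono)
      have "C1 / (s * exp v) \<le> C1 / (s * exp \<alpha>)"
        using v s C1 by (intro divide_left_mono mult_left_mono) auto
      then show "C1 / (s * exp v) \<le> C'" using C by (simp add: C'_def)
    qed (use s in auto)
    finally show ?thesis by (simp add: mult.assoc)
  qed
  then show ?thesis using C'0 by blast
qed

end

section \<open>Convergence of the series\<close>

lemma summable_power_times_geometric:
  fixes q :: real
  assumes q: "0 \<le> q" "q < 1"
  shows "summable (\<lambda>n. (real n + 1) ^ a * q ^ n)"
proof -
  have "(\<lambda>n. ((real n + 2) / (real n + 1)) ^ a * q) \<longlonglongrightarrow> 1 ^ a * q"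
  proof (intro tendsto_intros)
    have "(\<lambda>n. 1 + 1 / (real n + 1)) \<longlonglongrightarrow> 1 + 0"
      using LIMSEQ_inverse_real_of_nat by (intro tendsto_intros) (simp add: divide_inverse add.commute)
    then show "(\<lambda>n. (real n + 2) / (real n + 1)) \<longlonglongrightarrow> 1"
      by (simp add: field_simps)
  qed
  then have "\<forall>\<^sub>F n in sequentially. ((real n + 2) / (real n + 1)) ^ a * q < (1 + q) / 2"
    using q by (intro order_tendstoD(2)) auto
  then obtain N where N: "\<And>n. n \<ge> N \<Longrightarrow> ((real n + 2) / (real n + 1)) ^ a * q < (1 + q) / 2"
    by (auto simp: eventually_sequentially)
  show ?thesis
  proof (rule summable_ratio_test[of "(1 + q) / 2" N])
    fix n assume "n \<ge> N"
    have "(real (Suc n) + 1) ^ a * q ^ Suc n = ((real n + 2) / (real n + 1)) ^ a * q * ((real n + 1) ^ a * q ^ n)"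
      by (simp add: power_divide add.commute)
    also have "\<dots> \<le> (1 + q) / 2 * ((real n + 1) ^ a * q ^ n)"
      using N[OF \<open>n \<ge> N\<close>] q by (intro mult_right_mono) auto
    finally show "norm ((real (Suc n) + 1) ^ a * q ^ Suc n) \<le> (1 + q) / 2 * norm ((real n + 1) ^ a * q ^ n)"
      using q by simp
  qed (use q in simp)
qed

text \<open>The estimate common to the series (\<open>a = 1\<close>) and the remainder
  (\<open>a = 2\<close>), uniform for \<open>\<rho>\<close> between \<open>\<delta>\<close> and
  \<open>b\<close>. The factorials cancel and only \<open>w * (1 + \<rho>)\<close> is raised to the
  power \<open>n\<close>. The lower bound \<open>\<delta>\<close> serves the power \<open>e\<close>,
  which is nonpositive.\<close>

lemma node_sum_bound_geometric:
  fixes \<rho> \<delta> b w q C :: real and d k :: nat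
  assumes C: "0 \<le> C" and w: "0 \<le> w" and \<rho>: "0 < \<delta>" "\<delta> \<le> \<rho>" "\<rho> \<le> b" and q: "w * (1 + \<rho>) \<le> q" and d: "d > 1"
  defines "M \<equiv> 2 * k + d - 2" and "e \<equiv> 2 - int d - int k"
  shows "C * (real n + 1) ^ a * fact n * w ^ n * (real (n + M) ^ M * \<rho> powi e * (1 + \<rho>) ^ (n + M) / fact n)
    \<le> C * (real M + 1) ^ M * \<delta> powi e * (1 + b) ^ M * ((real n + 1) ^ (a + M) * q ^ n)"
proof -
  have "real (n + M) ^ M \<le> ((real M + 1) * (real n + 1)) ^ M"
    by (rule power_mono) (simp_all add: algebra_simps)
  then have 1: "real (n + M) ^ M \<le> (real M + 1) ^ M * (real n + 1) ^ M" by (simp add: power_mult_distrib)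
  have "e = - int (d + k - 2)" using d by (simp add: e_def)
  moreover have "inverse (\<rho> ^ m) \<le> inverse (\<delta> ^ m)" for m
    using \<rho> by (intro le_imp_inverse_le power_mono) auto
  ultimately have 2: "\<rho> powi e \<le> \<delta> powi e" by (simp add: power_int_minus)
  have 3: "(1 + \<rho>) ^ M \<le> (1 + b) ^ M" using \<rho> by (intro power_mono) auto
  have 4: "w ^ n * (1 + \<rho>) ^ n \<le> q ^ n"
    unfolding power_mult_distrib[symmetric] using q w \<rho> by (intro power_mono) auto
  have 0: "0 \<le> \<rho> powi e" "0 \<le> \<delta> powi e" using \<rho> by (auto simp: zero_le_power_int)
  have "C * (real n + 1) ^ a * fact n * w ^ n * (real (n + M) ^ M * \<rho> powi e * (1 + \<rho>) ^ (n + M) / fact n)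
      = C * (real n + 1) ^ a * (real (n + M) ^ M * (\<rho> powi e * ((1 + \<rho>) ^ M * (w ^ n * (1 + \<rho>) ^ n))))"
    by (simp add: power_add)
  also have "\<dots> \<le> C * (real n + 1) ^ a * (((real M + 1) ^ M * (real n + 1) ^ M) * (\<delta> powi e * ((1 + b) ^ M * q ^ n)))"
    by (intro mult_left_mono mult_mono 1 2 3 4 mult_nonneg_nonneg 0 zero_le_power) (use C w \<rho> in auto)
  also have "\<dots> = C * (real M + 1) ^ M * \<delta> powi e * (1 + b) ^ M * ((real n + 1) ^ (a + M) * q ^ n)"
    by (simp add: power_add mult_ac)
  finally show ?thesis .
qed

text \<open>The derivative telescopes: that of the \<open>n\<close>-th term is
  \<open>g (Suc n) t * exp_divdiff L n (v - t)\<close> minus the same expression for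
  \<open>n - 1\<close>, which is absent when \<open>n = 0\<close>.\<close>

lemma has_vector_derivative_taylor_sum:
  fixes g :: "nat \<Rightarrow> real \<Rightarrow> complex"
  assumes L: "inj L"
    and g: "\<And>n. (g n has_vector_derivative g (Suc n) t + of_int (L n) * g n t) (at t)"
  shows "((\<lambda>t. \<Sum>n<Suc m. g n t * exp_divdiff L n (v - t)) has_vector_derivative
    g (Suc m) t * exp_divdiff L m (v - t)) (at t)"
proof (induction m)
  have "((\<lambda>t. exp_divdiff L n (v - t)) has_vector_derivative
      - (of_int (L n) * exp_divdiff L n (v - t) + (case n of 0 \<Rightarrow> 0 | Suc m \<Rightarrow> exp_divdiff L m (v - t)))) (at t)" for n
  proof -
    have "((\<lambda>t. v - t) has_vector_derivative -1) (at t)" by (auto intro!: derivative_eq_intros)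
    from vector_diff_chain_at[OF this has_vector_derivative_exp_divdiff[OF L]]
    show ?thesis by (simp add: o_def)
  qed
  from has_vector_derivative_mult[OF g this]
  have step: "((\<lambda>t. g n t * exp_divdiff L n (v - t)) has_vector_derivative
      g (Suc n) t * exp_divdiff L n (v - t) - g n t * (case n of 0 \<Rightarrow> 0 | Suc m \<Rightarrow> exp_divdiff L m (v - t))) (at t)" for n
    by (rule has_vector_derivative_eq_rhs) (simp add: algebra_simps)
  {
    case 0
    show ?case using step[of 0] by simp
  next
    case (Suc m)
    have "((\<lambda>t. (\<Sum>n<Suc m. g n t * exp_divdiff L n (v - t)) + g (Suc m) t * exp_divdiff L (Suc m) (v - t))
        has_vector_derivative g (Suc (Suc m)) t * exp_divdiff L (Suc m) (v - t)) (at t)"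
      by (rule has_vector_derivative_eq_rhs[OF has_vector_derivative_add[OF Suc.IH step[of "Suc m"]]]) simp
    then show ?case by (simp only: sum.lessThan_Suc[of _ "Suc m"])
  }
qed

context radial_ode
begin

text \<open>With \<open>S\<^sub>N(t) = \<Sum>\<^bsub>n<N\<^esub> D\<^sup>(\<^sup>n\<^sup>)g(t) \<phi>\<^sub>n(v - t)\<close>, the function \<open>S\<^sub>N\<close> takes the value \<open>g(v)\<close> at
  \<open>t = v\<close> and is the partial sum of the series at \<open>t = v\<^sub>0\<close>, while \<open>S\<^sub>N'(t) = D\<^sup>(\<^sup>N\<^sup>)g(t) \<phi>\<^bsub>N-1\<^esub>(v - t)\<close>.\<close>
lemma taylor_series_converges:
  assumes d: "odd d" "d > 1" and ab: "{\<alpha>..\<beta>} \<subseteq> J" and s: "s > 0" "2 * s * exp \<beta> < 1" and C: "C > 0"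
    and Dop_le: "\<And>n v. v \<in> {\<alpha>..\<beta>} \<Longrightarrow> norm (Dop L n (H 0) v) \<le> C * (real n + 1) * fact n * (s * exp v) ^ n"
    and v0: "v0 \<in> {\<alpha>..\<beta>}" and v: "v \<in> {\<alpha>..\<beta>}"
  shows "(\<lambda>N. \<Sum>n<N. Dop L n (H 0) v0 * exp_divdiff L n (v - v0)) \<longlonglongrightarrow> H 0 v"
proof -
  note Linj = lam_inj[OF d(1), of k]
  define M where "M = 2 * k + d - 2"
  define e where "e = 2 - int d - int k"
  \<comment> \<open>\<open>\<delta>\<close> and \<open>b\<close> enclose \<open>exp (v - t)\<close>
    for all \<open>t\<close> in \<open>{\<alpha>..\<beta>}\<close>.\<close>
  define b where "b = exp (\<beta> - \<alpha>)"
  define \<delta> where "\<delta> = exp (\<alpha> - \<beta>)"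
  define q where "q = 2 * s * exp \<beta>"
  define K where "K = (2 * C * s * exp \<beta>) * (real M + 1) ^ M * \<delta> powi e * (1 + b) ^ M"
  define S where "S N t = (\<Sum>n<N. Dop L n (H 0) t * exp_divdiff L n (v - t))" for N t
  have bound: "norm (Dop L (Suc m) (H 0) t * exp_divdiff L m (v - t)) \<le> K * ((real m + 1) ^ (2 + M) * q ^ m)"
    if t: "t \<in> {\<alpha>..\<beta>}" for m t
  proof -
    have w: "s * exp t * (1 + exp (v - t)) \<le> q"
    proof -
      have "s * exp t * (1 + exp (v - t)) = s * (exp t + exp v)" by (simp add: exp_diff field_simps)
      also have "\<dots> \<le> s * (exp \<beta> + exp \<beta>)" using s t v by (intro mult_left_mono add_mono) auto
      finally show ?thesis by (simp add: q_def)
    qed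
    \<comment> \<open>Order \<open>m + 1\<close> meets a divided difference of index
      \<open>m\<close>. The surplus \<open>(m + 2) (m + 1) s exp t\<close> is absorbed by the
      constant and by \<open>(m + 1)^2\<close>, using \<open>m + 2 \<le> 2 (m + 1)\<close>.\<close>
    have "norm (Dop L (Suc m) (H 0) t) \<le> C * (real (Suc m) + 1) * fact (Suc m) * (s * exp t) ^ Suc m"
      by (rule Dop_le[OF t])
    also have "\<dots> = (C * s * exp t * (real m + 2)) * ((real m + 1) * fact m * (s * exp t) ^ m)"
      by (simp add: algebra_simps)
    also have "\<dots> \<le> (C * s * exp \<beta> * (2 * (real m + 1))) * ((real m + 1) * fact m * (s * exp t) ^ m)"
      by (intro mult_right_mono mult_mono) (use s C t in auto)
    also have "\<dots> = 2 * C * s * exp \<beta> * (real m + 1) ^ 2 * fact m * (s * exp t) ^ m"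
      by (simp add: power2_eq_square)
    finally have "norm (Dop L (Suc m) (H 0) t * exp_divdiff L m (v - t))
        \<le> 2 * C * s * exp \<beta> * (real m + 1) ^ 2 * fact m * (s * exp t) ^ m *
          (real (m + M) ^ M * exp (v - t) powi e * (1 + exp (v - t)) ^ (m + M) / fact m)"
      unfolding norm_mult M_def e_def
      by (intro mult_mono norm_exp_divdiff_le[OF d]) (use s C in \<open>auto simp del: Dop.simps\<close>)
    also have "\<dots> \<le> K * ((real m + 1) ^ (2 + M) * q ^ m)"
      unfolding K_def M_def e_def
      by (rule node_sum_bound_geometric) (use s C t v d w in \<open>auto simp: \<delta>_def b_def\<close>)
    finally show ?thesis .
  qed
  \<comment> \<open>The mean value inequality between \<open>v\<close> and \<open>v0\<close> takes
    the place of the remainder integral.\<close>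
  have bnd: "norm (S (Suc m) v0 - H 0 v) \<le> K * ((real m + 1) ^ (2 + M) * q ^ m) * \<bar>v0 - v\<bar>" for m
  proof -
    have deriv: "(S (Suc m) has_vector_derivative Dop L (Suc m) (H 0) t * exp_divdiff L m (v - t)) (at t)"
      if "t \<in> {\<alpha>..\<beta>}" for t
      unfolding S_def[abs_def]
      by (rule has_vector_derivative_taylor_sum[OF Linj has_vector_derivative_Dop]) (use that ab in blast)
    have "norm (S (Suc m) v0 - S (Suc m) v - (v0 - v) *\<^sub>R 0) \<le> K * ((real m + 1) ^ (2 + M) * q ^ m) * \<bar>v0 - v\<bar>"
      by (rule vector_derivative_linear_bound[of "{\<alpha>..\<beta>}", OF _ v v0 deriv]) (use bound in \<open>auto simp del: Dop.simps\<close>)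
    moreover have "S (Suc m) v = H 0 v"
    proof -
      have "S (Suc m) v = (\<Sum>n<Suc m. if n = 0 then H 0 v else 0)"
        unfolding S_def by (intro sum.cong) (auto simp: exp_divdiff_0[OF Linj])
      then show ?thesis by simp
    qed
    ultimately show ?thesis by simp
  qed
  have lim: "(\<lambda>m. K * ((real m + 1) ^ (2 + M) * q ^ m) * \<bar>v0 - v\<bar>) \<longlonglongrightarrow> 0"
  proof -
    have "(\<lambda>m. (real m + 1) ^ (2 + M) * q ^ m) \<longlonglongrightarrow> 0"
      by (rule summable_LIMSEQ_zero[OF summable_power_times_geometric]) (use s in \<open>auto simp: q_def\<close>)
    then show ?thesis by (intro tendsto_mult_left_zero tendsto_mult_right_zero)
  qed
  have "(\<lambda>m. S (Suc m) v0 - H 0 v) \<longlonglongrightarrow> 0"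
    by (rule Lim_null_comparison[OF always_eventually[OF allI[OF bnd]] lim])
  then have "(\<lambda>m. S (Suc m) v0) \<longlonglongrightarrow> H 0 v" by (simp add: LIM_zero_iff)
  then have "(\<lambda>N. S N v0) \<longlonglongrightarrow> H 0 v" by (rule LIMSEQ_imp_Suc)
  then show ?thesis unfolding S_def .
qed

end

text \<open>The exponential and the power of \<open>z\<close> in each term combine to
  \<open>\<rho> powi (lam d k j)\<close> with \<open>\<rho> = norm z * exp (- v0)\<close>, and
  \<open>s * exp v0 * (1 + \<rho>) = s * (exp v0 + norm z)\<close>. The bounds
  \<open>\<delta>\<close> and \<open>R\<close> make the result independent of \<open>z\<close> on a
  compact set.\<close>

lemma sum_norm_terms_le:
  fixes z c :: complex and d k :: nat
  assumes d: "odd d" "d > 1" and z: "z \<noteq> 0" and s: "s \<ge> 0" and C: "C \<ge> 0"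
    and c: "norm c \<le> C * (real n + 1) * fact n * (s * exp v0) ^ n"
    and \<delta>: "0 < \<delta>" "\<delta> \<le> norm z * exp (- v0)" and R: "norm z \<le> R"
  defines "M \<equiv> 2 * k + d - 2"
  shows "(\<Sum>j\<le>n. norm (c * of_real (exp (- real_of_int (lam d k j) * v0)) / node_denom (lam d k) n j * z powi (lam d k j)))
    \<le> C * (real M + 1) ^ M * \<delta> powi (2 - int d - int k) * (1 + R * exp (- v0)) ^ M
       * ((real n + 1) ^ (1 + M) * (s * (exp v0 + R)) ^ n)"
proof -
  define \<rho> where "\<rho> = norm z * exp (- v0)"
  have \<rho>: "\<rho> > 0" using z by (simp add: \<rho>_def)
  have q: "s * exp v0 * (1 + \<rho>) \<le> s * (exp v0 + R)"
  proof -
    have "s * exp v0 * (1 + \<rho>) = s * (exp v0 + norm z)" by (simp add: \<rho>_def exp_minus field_simps)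
    also have "\<dots> \<le> s * (exp v0 + R)" using R s by (intro mult_left_mono) auto
    finally show ?thesis .
  qed
  have "norm (c * of_real (exp (- real_of_int m * v0)) / D * z powi m) = norm c * (\<rho> powi m / norm D)" for m and D :: complex
  proof -
    have "exp (- real_of_int m * v0) = exp (- v0) powi m" by (simp add: exp_power_int)
    then show ?thesis
      unfolding norm_mult norm_divide norm_power_int norm_of_real \<rho>_def power_int_mult_distrib by simp
  qed
  note norm_term = this
  have "(\<Sum>j\<le>n. norm (c * of_real (exp (- real_of_int (lam d k j) * v0)) / node_denom (lam d k) n j * z powi (lam d k j)))
      = norm c * (\<Sum>j\<le>n. \<rho> powi (lam d k j) / norm (node_denom (lam d k) n j))"
    by (simp only: norm_term sum_distrib_left)
  also have "\<dots> \<le> (C * (real n + 1) ^ 1 * fact n * (s * exp v0) ^ n) *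
      (real (n + M) ^ M * \<rho> powi (2 - int d - int k) * (1 + \<rho>) ^ (n + M) / fact n)"
    unfolding M_def by (intro mult_mono sum_power_over_node_denom_le[OF d \<rho>])
      (use c C s \<rho> in \<open>auto intro!: sum_nonneg simp: zero_le_power_int\<close>)
  also have "\<dots> \<le> C * (real M + 1) ^ M * \<delta> powi (2 - int d - int k) * (1 + R * exp (- v0)) ^ M
       * ((real n + 1) ^ (1 + M) * (s * (exp v0 + R)) ^ n)"
    unfolding M_def by (rule node_sum_bound_geometric) (use C s \<delta> R q d in \<open>auto simp: \<rho>_def\<close>)
  finally show ?thesis .
qed

section \<open>Annuli in the logarithmic radius and the final assembly\<close>

lemma ereal_less_inv2_iff: "0 \<le> \<tau> \<Longrightarrow> ereal x < inv2 \<tau> \<longleftrightarrow> 2 * \<tau> * x < 1"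
  by (auto simp: inv2_def field_simps)

lemma open_annulus: "open (annulus r0 r1)"
proof -
  have "open {x :: real^'n. ereal (norm x) < r1}"
    by (intro open_Collect_less continuous_intros)
  moreover have "open {x :: real^'n. r0 < norm x}"
    by (intro open_Collect_less continuous_intros)
  ultimately show ?thesis unfolding annulus_def Collect_conj_eq by (rule open_Int[rotated])
qed

lemma open_log_annulus: "open {v. r0 < exp v \<and> ereal (exp v) < r1}"
proof -
  have "open {v. ereal (exp v) < r1}" by (intro open_Collect_less continuous_intros)
  moreover have "open {v::real. r0 < exp v}" by (intro open_Collect_less continuous_intros)
  ultimately show ?thesis unfolding Collect_conj_eq by (rule open_Int[rotated])
qed

lemma interval_log_annulus:
  assumes "r0 < exp \<alpha>" "ereal (exp \<beta>) < r1"
  shows "{\<alpha>..\<beta>} \<subseteq> {v. r0 < exp v \<and> ereal (exp v) < r1}"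
proof
  fix v assume "v \<in> {\<alpha>..\<beta>}"
  then have "exp \<alpha> \<le> exp v" "ereal (exp v) \<le> ereal (exp \<beta>)" by auto
  then show "v \<in> {v. r0 < exp v \<and> ereal (exp v) < r1}"
    using less_le_trans[OF assms(1)] le_less_trans[OF _ assms(2)] by simp
qed

text \<open>The closed shell between the radii \<open>exp \<alpha>\<close> and
  \<open>exp \<beta>\<close> is compact in the annulus, and polyharmonicity is applied there with
  \<open>\<epsilon> = s - \<tau>\<close>. Integrating against \<open>P\<close> costs a factor
  independent of \<open>p\<close>.\<close>

lemma fcoef_lap_bound:
  fixes f P :: "real^'n::finite \<Rightarrow> complex"
  assumes f: "polyharmonic_inf (annulus r0 r1) \<tau> f" and P: "hom_harm_poly k P"
    and ab: "r0 < exp \<alpha>" "ereal (exp \<beta>) < r1" and s: "\<tau> < s"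
  shows "\<exists>C>0. \<forall>p. \<forall>v\<in>{\<alpha>..\<beta>}. norm (fcoef ((lap ^^ p) f) P (exp v)) \<le> C * fact (2 * p) * s ^ (2 * p)"
proof -
  let ?G = "annulus r0 r1 :: (real^'n) set"
  define K where "K = {x :: real^'n. exp \<alpha> \<le> norm x \<and> norm x \<le> exp \<beta>}"
  have KG: "K \<subseteq> ?G"
  proof
    fix x assume "x \<in> K"
    then have "exp \<alpha> \<le> norm x" "ereal (norm x) \<le> ereal (exp \<beta>)" by (auto simp: K_def)
    then show "x \<in> ?G"
      using less_le_trans[OF ab(1)] le_less_trans[OF _ ab(2)] by (simp add: annulus_def)
  qed
  have "closed K" unfolding K_def by (intro closed_Collect_conj closed_Collect_le continuous_intros)
  moreover have "bounded K" unfolding K_def by (rule boundedI[of _ "exp \<beta>"]) auto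
  ultimately have "compact K" by (simp add: compact_eq_bounded_closed)
  then obtain C where C: "C > 0"
    and f_le: "\<And>p x. x \<in> K \<Longrightarrow> norm ((lap ^^ p) f x) \<le> C * fact (2 * p) * (\<tau> + (s - \<tau>)) ^ (2 * p)"
    using f KG s unfolding polyharmonic_inf_def by (elim conjE allE[of _ K] allE[of _ "s - \<tau>"]) auto
  obtain C' where C': "C' > 0" and bound:
    "\<And>(h :: real^'n \<Rightarrow> complex) B. continuous_on (sphere 0 1) h \<Longrightarrow>
       (\<And>\<theta>. norm \<theta> = 1 \<Longrightarrow> norm (h \<theta>) \<le> B) \<Longrightarrow> norm (sph_int h) \<le> C' * B"
    using sph_int_bound[where 'n='n] by blast
  have Q: "continuous_on S (\<lambda>x. cnj (P x))" for S
    using C1_onD(3)[OF polyfun_pd(2)[OF hom_harm_poly_cnj(1)[OF P]]] continuous_on_subset by blast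
  have "compact ((\<lambda>x. cnj (P x)) ` sphere 0 1)" by (intro compact_continuous_image Q compact_sphere)
  from compact_imp_bounded[OF this] obtain B where B: "B > 0"
    and "\<forall>y\<in>(\<lambda>x. cnj (P x)) ` sphere 0 1. norm y \<le> B"
    unfolding bounded_pos by blast
  then have P_le: "norm (P x) \<le> B" if "norm x = 1" for x
    using that by simp
  have "norm (fcoef ((lap ^^ p) f) P (exp v)) \<le> C' * (C * fact (2 * p) * s ^ (2 * p) * B)" if v: "v \<in> {\<alpha>..\<beta>}" for p v
    unfolding fcoef_def
  proof (rule bound)
    have in_K: "exp v *\<^sub>R \<theta> \<in> K" if "norm \<theta> = 1" for \<theta> :: "real^'n" using that v by (simp add: K_def)
    have "smooth_on ?G f" using f by (simp add: polyharmonic_inf_def)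
    then have "continuous_on ?G ((lap ^^ p) f)"
      by (rule C1_onD(3)[OF smooth_on_C1_on[OF open_annulus smooth_on_lap_pow[OF open_annulus]]])
    then have "continuous_on (sphere 0 1) (\<lambda>\<theta>. (lap ^^ p) f (exp v *\<^sub>R \<theta>))"
      by (rule continuous_on_compose2) (use in_K KG in \<open>auto intro!: continuous_intros\<close>)
    then show "continuous_on (sphere 0 1) (\<lambda>\<theta>. (lap ^^ p) f (exp v *\<^sub>R \<theta>) * cnj (P \<theta>))"
      by (rule continuous_on_mult[OF _ Q])
    show "norm ((lap ^^ p) f (exp v *\<^sub>R \<theta>) * cnj (P \<theta>)) \<le> C * fact (2 * p) * s ^ (2 * p) * B" if "norm \<theta> = 1" for \<theta>
      unfolding norm_mult complex_mod_cnj
    proof (rule mult_mono)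
      show "norm ((lap ^^ p) f (exp v *\<^sub>R \<theta>)) \<le> C * fact (2 * p) * s ^ (2 * p)"
        using f_le[OF in_K[OF that], of p] by simp
      show "0 \<le> C * fact (2 * p) * s ^ (2 * p)"
        using C by (simp add: power_mult)
    qed (use B P_le[OF that] in auto)
  qed
  then show ?thesis
    using C C' B by (intro exI[of _ "C' * C * B"]) (simp add: mult_ac)
qed

theorem mainTheorem14:
  fixes f :: "real^'n::finite \<Rightarrow> complex"
    and r0 :: real and r1 :: ereal and \<tau> :: real
    and k :: nat and a :: nat and l :: nat
    and Y :: "nat \<Rightarrow> real^'n \<Rightarrow> complex"
    and v0 :: real
  assumes d_odd: "odd CARD('n)" and d_gt1: "CARD('n) > 1"
    and r0: "0 \<le> r0" and r01: "ereal r0 < r1"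
    and tau: "0 \<le> \<tau>" and tau_r0: "ereal \<tau> < inv2 r0"
    and f: "polyharmonic_inf (annulus r0 r1) \<tau> f"
    and Y: "sph_harm_onb k a Y" and l: "l \<in> {1..a}"
    and v0: "r0 < exp v0" "ereal (exp v0) < min r1 (inv2 \<tau>)"
  shows
    "let d = CARD('n);
         L = lam d k;
         trm = (\<lambda>n j (z::complex).
                  Dop L n (\<lambda>v. fcoef f (Y l) (exp v)) v0
                  * of_real (exp (- real_of_int (L j) * v0))
                  / poly (pderiv (qpoly d k n)) (of_int (L j))
                  * z powi (L j));
         F = (\<lambda>z. \<Sum>n. \<Sum>j\<le>n. trm n j z);
         \<Omega> = {z::complex. 0 < norm z \<and> ereal (norm z) < inv2 \<tau>}
     in (\<forall>K. compact K \<and> K \<subseteq> \<Omega> \<longrightarrow>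
           uniformly_convergent_on K (\<lambda>N z. \<Sum>n<N. \<Sum>j\<le>n. norm (trm n j z)) \<and>
           uniform_limit K (\<lambda>N z. \<Sum>n<N. \<Sum>j\<le>n. trm n j z) F sequentially)
      \<and> (\<forall>r. r0 < r \<and> ereal r < min r1 (inv2 \<tau>) \<longrightarrow> F (of_real r) = fcoef f (Y l) r)"
proof -
  let ?d = "CARD('n)" and ?G = "annulus r0 r1 :: (real^'n) set"
  have P: "hom_harm_poly k (Y l)" using Y l by (simp add: sph_harm_onb_def)
  define J where "J = {v. r0 < exp v \<and> ereal (exp v) < r1}"
  define H where "H p v = fcoef ((lap ^^ p) f) (Y l) (exp v)" for p v
  have sm: "smooth_on ?G ((lap ^^ p) f)" for p
    by (rule smooth_on_lap_pow[OF open_annulus]) (use f in \<open>simp add: polyharmonic_inf_def\<close>)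
  have JG: "exp t *\<^sub>R \<theta> \<in> ?G" if "t \<in> J" "norm \<theta> = 1" for t \<theta>
    using that by (simp add: J_def annulus_def)
  have J: "open J" unfolding J_def by (rule open_log_annulus)
  \<comment> \<open>Packed into one predicate so that \<open>H1\<close> and \<open>H2\<close> can be
    chosen for all \<open>p\<close> at once.\<close>
  define ode where "ode p A B \<longleftrightarrow> (\<forall>v\<in>J. (H p has_vector_derivative A v) (at v) \<and> (A has_vector_derivative B v) (at v) \<and>
      B v + (of_nat ?d - 2) * A v - of_nat k * (of_nat k + of_nat ?d - 2) * H p v = of_real (exp v ^ 2) * H (Suc p) v)" for p A B
  have "\<exists>A B. ode p A B" for p
  proof (rule fcoef_exp_ode[OF P open_annulus sm[of p] J])
    show "exp t *\<^sub>R \<theta> \<in> ?G" if "t \<in> J" "norm \<theta> = 1" for t \<theta> by (rule JG[OF that])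
    fix A B
    assume "\<And>v. v \<in> J \<Longrightarrow> ((\<lambda>v. fcoef ((lap ^^ p) f) (Y l) (exp v)) has_vector_derivative A v) (at v)"
      and "\<And>v. v \<in> J \<Longrightarrow> (A has_vector_derivative B v) (at v)"
      and "\<And>v. v \<in> J \<Longrightarrow> B v + (of_nat ?d - 2) * A v - of_nat k * (of_nat k + of_nat ?d - 2) * fcoef ((lap ^^ p) f) (Y l) (exp v)
        = of_real (exp v ^ 2) * fcoef (lap ((lap ^^ p) f)) (Y l) (exp v)"
    then have "ode p A B" by (simp add: ode_def H_def[abs_def])
    then show "\<exists>A B. ode p A B" by blast
  qed
  then obtain H1 H2 where "\<And>p. ode p (H1 p) (H2 p)" by metis
  then have H12: "(H p has_vector_derivative H1 p v) (at v)" "(H1 p has_vector_derivative H2 p v) (at v)"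
      "H2 p v + (of_nat ?d - 2) * H1 p v - of_nat k * (of_nat k + of_nat ?d - 2) * H p v = of_real (exp v ^ 2) * H (Suc p) v"
    if "v \<in> J" for p v
    using that unfolding ode_def by blast+
  interpret radial_ode ?d k J H H1 H2
    by unfold_locales (fact J | fact H12)+
  have Dop_le: "\<exists>C>0. \<forall>n. \<forall>v\<in>{\<alpha>..\<beta>}. norm (Dop L n (H 0) v) \<le> C * (real n + 1) * fact n * (s * exp v) ^ n"
    if ab: "\<alpha> < \<beta>" "r0 < exp \<alpha>" "ereal (exp \<beta>) < r1" and s: "\<tau> < s" for \<alpha> \<beta> s
  proof -
    have s0: "s > 0" using tau s by simp
    obtain C where C: "C > 0" "\<And>p v. v \<in> {\<alpha>..\<beta>} \<Longrightarrow> norm (H p v) \<le> C * fact (2 * p) * s ^ (2 * p)"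
      using fcoef_lap_bound[OF f P ab(2,3) s] unfolding H_def by blast
    show ?thesis
      by (rule Dop_bound[OF ab(1) _ s0 C]) (use interval_log_annulus[OF ab(2,3)] in \<open>simp_all add: J_def\<close>)
  qed
  \<comment> \<open>The interval is nondegenerate even for \<open>v = w\<close>: the interpolation
    for odd orders needs room around a single point.\<close>
  have enlarge: "\<exists>\<alpha> \<beta>. \<alpha> < \<beta> \<and> v \<in> {\<alpha>..\<beta>} \<and> w \<in> {\<alpha>..\<beta>} \<and> r0 < exp \<alpha> \<and> ereal (exp \<beta>) < min r1 (inv2 \<tau>)"
    if "r0 < exp v" "ereal (exp v) < min r1 (inv2 \<tau>)" "r0 < exp w" "ereal (exp w) < min r1 (inv2 \<tau>)" for v w
  proof -
    let ?T = "{v. r0 < exp v \<and> ereal (exp v) < min r1 (inv2 \<tau>)}"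
    have "max v w \<in> ?T" "min v w \<in> ?T" using that by (auto simp: max_def min_def split: if_splits)
    then obtain e1 e2 where "e1 > 0" "cball (max v w) e1 \<subseteq> ?T" "e2 > 0" "cball (min v w) e2 \<subseteq> ?T"
      using open_log_annulus[of r0 "min r1 (inv2 \<tau>)"] unfolding open_contains_cball by blast
    then have "max v w + e1 \<in> ?T" "min v w - e2 \<in> ?T" "e1 > 0" "e2 > 0"
      by (auto simp: subset_iff dist_norm)
    then show ?thesis
      by (intro exI[of _ "min v w - e2"] exI[of _ "max v w + e1"]) auto
  qed
  have v0tau: "2 * \<tau> * exp v0 < 1"
    using v0(2) ereal_less_inv2_iff[OF tau] by auto
  define trm where "trm n j z = Dop L n (\<lambda>v. fcoef f (Y l) (exp v)) v0
      * of_real (exp (- real_of_int (L j) * v0)) / poly (pderiv (qpoly ?d k n)) (of_int (L j)) * z powi (L j)"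
    for n j and z :: complex
  have H0: "H 0 = (\<lambda>v. fcoef f (Y l) (exp v))" by (simp add: H_def[abs_def])
  have trm: "trm n j z = Dop L n (H 0) v0 * of_real (exp (- real_of_int (L j) * v0)) / node_denom L n j * z powi (L j)"
    if "j \<le> n" for n j z
    unfolding trm_def H0 poly_pderiv_qpoly[OF that] ..
  have conv: "uniformly_convergent_on K (\<lambda>N z. \<Sum>n<N. \<Sum>j\<le>n. norm (trm n j z)) \<and>
      uniform_limit K (\<lambda>N z. \<Sum>n<N. \<Sum>j\<le>n. trm n j z) (\<lambda>z. \<Sum>n. \<Sum>j\<le>n. trm n j z) sequentially"
    if K: "compact K" "K \<subseteq> {z. 0 < norm z \<and> ereal (norm z) < inv2 \<tau>}" for K
  proof (cases "K = {}")
    case False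
    obtain zR where zR: "zR \<in> K" "\<And>z. z \<in> K \<Longrightarrow> norm z \<le> norm zR"
      using continuous_attains_sup[OF K(1) False continuous_on_norm_id] by blast
    obtain zr where zr: "zr \<in> K" "\<And>z. z \<in> K \<Longrightarrow> norm zr \<le> norm z"
      using continuous_attains_inf[OF K(1) False continuous_on_norm_id] by blast
    define R where "R = norm zR"
    \<comment> \<open>The minimum of \<open>norm\<close> on \<open>K\<close> is attained and
      positive, which keeps the negative powers of \<open>z\<close> bounded.\<close>
    define \<delta> where "\<delta> = norm zr * exp (- v0)"
    have \<delta>: "\<delta> > 0" using K zr by (auto simp: \<delta>_def)
    have R: "R \<ge> 0" "2 * \<tau> * R < 1" using K zR ereal_less_inv2_iff[OF tau] by (auto simp: R_def)
    define e where "e = exp v0 + R"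
    have e: "e > 0" unfolding e_def using R by (intro add_pos_nonneg) auto
    moreover have "\<tau> * e < 1" using R v0tau by (simp add: e_def algebra_simps)
    ultimately have e: "e > 0" "\<tau> * e < 1" by simp_all
    \<comment> \<open>\<open>exp v0\<close> and \<open>R\<close> each satisfy
      \<open>2 * \<tau> * x < 1\<close>, so \<open>\<tau> * e < 1\<close>; the midpoint of
      \<open>\<tau>\<close> and \<open>1 / e\<close> leaves room on both sides, also for
      \<open>\<tau> = 0\<close>.\<close>
    define s where "s = (\<tau> + 1 / e) / 2"
    have s: "\<tau> < s" "s * e < 1" using e by (simp_all add: s_def field_simps)
    obtain \<alpha> \<beta> where "\<alpha> < \<beta>" "v0 \<in> {\<alpha>..\<beta>}" "r0 < exp \<alpha>" "ereal (exp \<beta>) < r1"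
      using enlarge[OF v0 v0] by auto
    then obtain C where C: "C > 0" "\<And>n. norm (Dop L n (H 0) v0) \<le> C * (real n + 1) * fact n * (s * exp v0) ^ n"
      using Dop_le[of \<alpha> \<beta> s] s by blast
    define M where "M = 2 * k + ?d - 2"
    define B where "B n = C * (real M + 1) ^ M * \<delta> powi (2 - int ?d - int k) * (1 + R * exp (- v0)) ^ M
       * ((real n + 1) ^ (1 + M) * (s * e) ^ n)" for n
    have le: "(\<Sum>j\<le>n. norm (trm n j z)) \<le> B n" if z: "z \<in> K" for n z
    proof -
      have "(\<Sum>j\<le>n. norm (trm n j z)) = (\<Sum>j\<le>n. norm (Dop L n (H 0) v0 * of_real (exp (- real_of_int (L j) * v0)) / node_denom L n j * z powi (L j)))"
        by (intro sum.cong refl) (simp only: trm atMost_iff)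
      also have "\<dots> \<le> B n"
        unfolding B_def M_def e_def
      proof (rule sum_norm_terms_le[OF d_odd d_gt1 _ _ _ C(2) \<delta>])
        show "z \<noteq> 0" using z K by auto
        show "\<delta> \<le> norm z * exp (- v0)" using zr(2)[OF z] by (simp add: \<delta>_def)
        show "norm z \<le> R" using zR(2)[OF z] by (simp add: R_def)
      qed (use C s tau in auto)
      finally show ?thesis .
    qed
    have sumB: "summable B"
      unfolding B_def using s e tau by (intro summable_mult summable_power_times_geometric) auto
    show ?thesis
    proof
      show "uniformly_convergent_on K (\<lambda>N z. \<Sum>n<N. \<Sum>j\<le>n. norm (trm n j z))"
        by (rule Weierstrass_m_test'[OF _ sumB]) (use le in \<open>simp add: sum_nonneg\<close>)
      show "uniform_limit K (\<lambda>N z. \<Sum>n<N. \<Sum>j\<le>n. trm n j z) (\<lambda>z. \<Sum>n. \<Sum>j\<le>n. trm n j z) sequentially"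
        by (rule Weierstrass_m_test[OF _ sumB]) (use le in \<open>blast intro: order_trans[OF norm_sum]\<close>)
    qed
  qed (simp add: uniformly_convergent_on_def)
  have val: "(\<Sum>n. \<Sum>j\<le>n. trm n j (of_real r)) = fcoef f (Y l) r"
    if r: "r0 < r" "ereal r < min r1 (inv2 \<tau>)" for r
  proof -
    define v where "v = ln r"
    have rv: "r = exp v" using r r0 by (simp add: v_def)
    obtain \<alpha> \<beta> where ab: "\<alpha> < \<beta>" "v0 \<in> {\<alpha>..\<beta>}" "v \<in> {\<alpha>..\<beta>}" "r0 < exp \<alpha>" "ereal (exp \<beta>) < min r1 (inv2 \<tau>)"
      using enlarge[OF v0, of v] r unfolding rv by auto
    have b: "ereal (exp \<beta>) < r1" "2 * \<tau> * exp \<beta> < 1" using ab(5) ereal_less_inv2_iff[OF tau] by auto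
    \<comment> \<open>Again a midpoint, now below \<open>1 / (2 * exp \<beta>)\<close>: in the
      remainder both radii \<open>exp t\<close> and \<open>exp v\<close> may come up to
      \<open>exp \<beta>\<close>.\<close>
    define s where "s = (\<tau> + 1 / (2 * exp \<beta>)) / 2"
    have s: "\<tau> < s" "2 * s * exp \<beta> < 1" using b(2) by (simp_all add: s_def field_simps)
    obtain C where C: "C > 0" "\<And>n v. v \<in> {\<alpha>..\<beta>} \<Longrightarrow> norm (Dop L n (H 0) v) \<le> C * (real n + 1) * fact n * (s * exp v) ^ n"
      using Dop_le[OF ab(1,4) b(1) s(1)] by blast
    have "(\<lambda>N. \<Sum>n<N. Dop L n (H 0) v0 * exp_divdiff L n (v - v0)) \<longlonglongrightarrow> H 0 v"
      by (rule taylor_series_converges[OF d_odd d_gt1 _ _ s(2) C ab(2,3)])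
        (use interval_log_annulus[OF ab(4) b(1)] s tau in \<open>auto simp: J_def\<close>)
    moreover have "Dop L n (H 0) v0 * exp_divdiff L n (v - v0) = (\<Sum>j\<le>n. trm n j (of_real r))" for n
    proof -
      have "of_real (exp (of_int m * (v - v0))) = of_real (exp (- real_of_int m * v0)) * complex_of_real r powi m" for m
        by (simp add: rv exp_power_int right_diff_distrib exp_diff exp_minus divide_inverse flip: of_real_power_int)
      then show ?thesis
        unfolding exp_divdiff_def sum_distrib_left
        by (intro sum.cong refl) (simp add: trm del: Dop.simps)
    qed
    ultimately have "(\<lambda>n. \<Sum>j\<le>n. trm n j (of_real r)) sums H 0 v" by (simp add: sums_def)
    then show ?thesis by (simp add: sums_unique[symmetric] H_def rv)
  qed
  show ?thesis
    unfolding Let_def using conv val unfolding trm_def by blast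
qed

end
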